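(* Let $\phi, \psi \in [0,1]$, and let $C_{\phi,\psi}$ be the bivariate Marshall–Olkin copula, i.e. the bivariate cumulative distribution function with standard uniform margins on $[0,1]$ given by $$C_{\phi,\psi}(u,v) = \min\left(u^{1-\phi} v,\; u v^{1-\psi}\right), \qquad u,v \in [0,1].$$ Then the maximal correlation coefficient of $C_{\phi,\psi}$ is $$R(C_{\phi,\psi}) = \sqrt{\phi\psi}.$$
   Context: For a bivariate cumulative distribution function $H$ and a random vector $(X_1,X_2)$ with cdf $H$, the maximal correlation coefficient is $$R(H) := R(X_1,X_2) := \sup_{f,g} \mathrm{Corr}(f(X_1), g(X_2)),$$ where the supremum is taken over all (Borel measurable) functions $f,g:\mathbb{R}\to\mathbb{R}$ such that $\mathrm{Var}(f(X_1))$ and $\mathrm{Var}(g(X_2))$ exist and lie in $(0,\infty)$, and $\mathrm{Corr}$ denotes the Pearson correlation. *)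

theory Defs
  imports "HOL-Probability.Probability"
begin

subsection \<open>Pearson correlation and maximal correlation of a random vector\<close>

definition covariance :: "'a measure \<Rightarrow> ('a \<Rightarrow> real) \<Rightarrow> ('a \<Rightarrow> real) \<Rightarrow> real" where
  "covariance M X Y =
     integral\<^sup>L M (\<lambda>w. (X w - integral\<^sup>L M X) * (Y w - integral\<^sup>L M Y))"

definition pearson_corr :: "'a measure \<Rightarrow> ('a \<Rightarrow> real) \<Rightarrow> ('a \<Rightarrow> real) \<Rightarrow> real" where
  "pearson_corr M X Y =
     covariance M X Y / (sqrt (prob_space.variance M X) * sqrt (prob_space.variance M Y))"

text \<open>The Bochner integral of a non-integrable function is 0, so existence of the variance
  has to be required separately from its positivity.\<close>

definition has_pos_variance :: "'a measure \<Rightarrow> ('a \<Rightarrow> real) \<Rightarrow> bool" where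
  "has_pos_variance M X \<longleftrightarrow>
     integrable M X \<and> integrable M (\<lambda>w. (X w)\<^sup>2) \<and> 0 < prob_space.variance M X"

text \<open>The set below is bounded above by 1 (Cauchy-Schwarz), so the real supremum is
  meaningful as soon as neither \<open>X\<close> nor \<open>Y\<close> is almost surely constant.\<close>

definition max_corr :: "'a measure \<Rightarrow> ('a \<Rightarrow> real) \<Rightarrow> ('a \<Rightarrow> real) \<Rightarrow> real" where
  "max_corr M X Y =
     Sup {pearson_corr M (\<lambda>w. f (X w)) (\<lambda>w. g (Y w)) | f g :: real \<Rightarrow> real.
            f \<in> borel_measurable borel \<and> g \<in> borel_measurable borel \<and>
            has_pos_variance M (\<lambda>w. f (X w)) \<and> has_pos_variance M (\<lambda>w. g (Y w))}"

subsection \<open>Maximal correlation of a bivariate cdf\<close>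

definition has_joint_cdf ::
    "'a measure \<Rightarrow> ('a \<Rightarrow> real) \<Rightarrow> ('a \<Rightarrow> real) \<Rightarrow> (real \<Rightarrow> real \<Rightarrow> real) \<Rightarrow> bool" where
  "has_joint_cdf M X Y H \<longleftrightarrow>
     prob_space M \<and> X \<in> borel_measurable M \<and> Y \<in> borel_measurable M \<and>
     (\<forall>x y. measure M {w \<in> space M. X w \<le> x \<and> Y w \<le> y} = H x y)"

definition law_of_cdf :: "(real \<Rightarrow> real \<Rightarrow> real) \<Rightarrow> (real \<times> real) measure" where
  "law_of_cdf H = (THE N. sets N = sets borel \<and> has_joint_cdf N fst snd H)"

text \<open>The random vector with cdf \<open>H\<close> is taken to be the canonical one, i.e. the two coordinate
  projections under the law of \<open>H\<close>. The lemma \<open>max_corr_eq_max_corr_cdf\<close> below shows that every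
  other random vector with cdf \<open>H\<close> has the same maximal correlation.\<close>

definition max_corr_cdf :: "(real \<Rightarrow> real \<Rightarrow> real) \<Rightarrow> real" where
  "max_corr_cdf H = max_corr (law_of_cdf H) fst snd"

lemma joint_cdf_unique:
  assumes N: "sets N = sets borel" "has_joint_cdf N fst snd H"
    and N': "sets N' = sets borel" "has_joint_cdf N' fst snd H"
  shows "N = (N' :: (real \<times> real) measure)"
proof -
  interpret N: prob_space N using N by (simp add: has_joint_cdf_def)
  interpret N': prob_space N' using N' by (simp add: has_joint_cdf_def)
  have sp: "space N = UNIV" "space N' = UNIV"
    using sets_eq_imp_space_eq[OF N(1)] sets_eq_imp_space_eq[OF N'(1)] by simp_all
  have at: "{..a} = {w. fst w \<le> fst a \<and> snd w \<le> snd a}" for a :: "real \<times> real"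
    by (auto simp: less_eq_prod_def)
  have eq: "measure N {..a} = measure N' {..a}" for a
    using N(2) N'(2) unfolding at has_joint_cdf_def sp by simp
  show ?thesis
  proof (rule measure_eqI_generator_eq[where \<Omega>=UNIV and E="range atMost"
        and A="\<lambda>i. {..(real i, real i)}"])
    show "Int_stable (range (atMost :: real \<times> real \<Rightarrow> _))"
    proof (rule Int_stableI_image)
      fix a b :: "real \<times> real"
      show "\<exists>c\<in>UNIV. {..a} \<inter> {..b} = {..c}"
        by (intro bexI[of _ "(min (fst a) (fst b), min (snd a) (snd b))"])
          (auto simp: less_eq_prod_def)
    qed
    show "emeasure N X = emeasure N' X" if "X \<in> range atMost" for X
      using that eq by (auto simp: N.emeasure_eq_measure N'.emeasure_eq_measure)
    show "sets N = sigma_sets UNIV (range atMost)" "sets N' = sigma_sets UNIV (range atMost)"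
      using N(1) N'(1) by (simp_all add: borel_eq_atMost image_def)
    show "(\<Union>i. {..(real i, real i)}) = (UNIV :: (real \<times> real) set)"
    proof (intro equalityI subsetI UNIV_I)
      fix w :: "real \<times> real"
      obtain n :: nat where "max (fst w) (snd w) \<le> real n" using real_arch_simple by blast
      then show "w \<in> (\<Union>i. {..(real i, real i)})" by (auto simp: less_eq_prod_def)
    qed
  qed (auto simp: N.emeasure_eq_measure)
qed

lemma max_corr_eq_max_corr_cdf:
  assumes "has_joint_cdf M X Y H"
  shows "max_corr M X Y = max_corr_cdf H"
proof -
  interpret prob_space M using assms by (simp add: has_joint_cdf_def)
  have [measurable]: "X \<in> borel_measurable M" "Y \<in> borel_measurable M"
    using assms by (simp_all add: has_joint_cdf_def)
  define N where "N = distr M (borel :: (real \<times> real) measure) (\<lambda>w. (X w, Y w))"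
  have sets_N: "sets N = sets borel" by (simp add: N_def)
  have XY [measurable]: "(\<lambda>w. (X w, Y w)) \<in> M \<rightarrow>\<^sub>M borel"
    unfolding borel_prod[symmetric] by measurable
  have proj [measurable]: "fst \<in> borel_measurable N" "snd \<in> borel_measurable N"
    unfolding N_def
    by (auto simp: measurable_distr_eq1 intro!: borel_measurable_continuous_onI continuous_intros)
  have "measure N {w \<in> space N. fst w \<le> x \<and> snd w \<le> y} = H x y" for x y
  proof -
    have S: "{w \<in> space N. fst w \<le> x \<and> snd w \<le> y} \<in> sets N" by measurable
    show ?thesis
      using assms S unfolding N_def has_joint_cdf_def
      by (simp add: measure_distr) (auto simp: vimage_def Int_def conj_commute)
  qed
  then have cdf: "has_joint_cdf N fst snd H"
    using prob_space_distr[OF XY] proj unfolding has_joint_cdf_def N_def by blast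
  have law: "law_of_cdf H = N"
    unfolding law_of_cdf_def
    by (rule the_equality) (use sets_N cdf in \<open>auto intro: joint_cdf_unique\<close>)
  have int: "integral\<^sup>L N h = integral\<^sup>L M (\<lambda>w. h (X w, Y w))"
      "integrable N h = integrable M (\<lambda>w. h (X w, Y w))"
    if "h \<in> borel_measurable borel" for h :: "real \<times> real \<Rightarrow> real"
    unfolding N_def using that XY by (simp_all add: integral_distr integrable_distr_eq)
  have comp: "(\<lambda>w. f (fst w)) \<in> borel_measurable (borel :: (real \<times> real) measure)"
      "(\<lambda>w. f (snd w)) \<in> borel_measurable (borel :: (real \<times> real) measure)"
    if [measurable]: "f \<in> borel_measurable borel" for f :: "real \<Rightarrow> real"
    unfolding borel_prod[symmetric] by measurable
  have var: "has_pos_variance N (\<lambda>w. f (fst w)) = has_pos_variance M (\<lambda>w. f (X w))"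
      "has_pos_variance N (\<lambda>w. f (snd w)) = has_pos_variance M (\<lambda>w. f (Y w))"
    if "f \<in> borel_measurable borel" for f
    unfolding has_pos_variance_def using comp[OF that] by (simp_all add: int)
  have corr: "pearson_corr N (\<lambda>w. f (fst w)) (\<lambda>w. g (snd w)) =
      pearson_corr M (\<lambda>w. f (X w)) (\<lambda>w. g (Y w))"
    if "f \<in> borel_measurable borel" "g \<in> borel_measurable borel" for f g
  proof -
    note [measurable] = comp(1)[OF that(1)] comp(2)[OF that(2)]
    have "(\<lambda>w. (f (fst w) - c) * (g (snd w) - d)) \<in> borel_measurable (borel :: (real \<times> real) measure)"
        "(\<lambda>w. (f (fst w) - c)\<^sup>2) \<in> borel_measurable (borel :: (real \<times> real) measure)"
        "(\<lambda>w. (g (snd w) - d)\<^sup>2) \<in> borel_measurable (borel :: (real \<times> real) measure)" for c d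
      by measurable
    note eqs = this[THEN int(1)] comp(1)[OF that(1), THEN int(1)] comp(2)[OF that(2), THEN int(1)]
    show ?thesis
      unfolding pearson_corr_def covariance_def eqs by simp
  qed
  have conj: "f \<in> borel_measurable borel \<and> g \<in> borel_measurable borel \<and>
        has_pos_variance N (\<lambda>w. f (fst w)) \<and> has_pos_variance N (\<lambda>w. g (snd w)) \<longleftrightarrow>
      f \<in> borel_measurable borel \<and> g \<in> borel_measurable borel \<and>
        has_pos_variance M (\<lambda>w. f (X w)) \<and> has_pos_variance M (\<lambda>w. g (Y w))" for f g
    using var by blast
  show ?thesis
    unfolding max_corr_cdf_def law max_corr_def conj
    by (rule arg_cong[where f=Sup], rule Collect_cong, intro ex_cong1) (use corr in metis)
qed

subsection \<open>The Marshall-Olkin copula\<close>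

text \<open>Clamping the arguments to \<open>[0,1]\<close> extends a copula from the unit square to a cdf on the whole
  plane. Isabelle's convention \<open>0 powr 0 = 0\<close> is harmless here: if \<open>u = 0\<close> or \<open>v = 0\<close>, the minimum
  is 0 for either value of \<open>0\<^sup>0\<close>.\<close>

definition clamp01 :: "real \<Rightarrow> real" where
  "clamp01 x = max 0 (min 1 x)"

definition marshall_olkin :: "real \<Rightarrow> real \<Rightarrow> real \<Rightarrow> real \<Rightarrow> real" where
  "marshall_olkin \<phi> \<psi> x y =
     (let u = clamp01 x; v = clamp01 y
      in min (u powr (1 - \<phi>) * v) (u * v powr (1 - \<psi>)))"

end

theory Submission
  imports Defs
begin

text \<open>
  For independent \<open>A\<close>, \<open>B\<close>, \<open>Z\<close> with \<open>Z\<close> uniform and \<open>A\<close>, \<open>B\<close> having distribution functions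
  \<open>x\<^bsup>1-\<phi>\<^esup>\<close> and \<open>x\<^bsup>1-\<psi>\<^esup>\<close>, the vector \<open>X = max A Z\<^bsup>1/\<phi>\<^esup>\<close>, \<open>Y = max B Z\<^bsup>1/\<psi>\<^esup>\<close> has
  cdf \<open>C\<^bsub>\<phi>,\<psi>\<^esub>\<close>. Since \<open>X\<close> and \<open>Y\<close> are conditionally independent given \<open>Z\<close>, Cauchy-Schwarz reduces
  the upper bound to \<open>Var E[f(X) | Z] \<le> \<phi> Var f(X)\<close> and its analogue for \<open>Y\<close>.

  To see this inequality, let \<open>W\<close>, \<open>W'\<close> be independent copies of \<open>Z\<^bsup>1/\<phi>\<^esup>\<close>. The conditional
  expectations at \<open>W\<close> and \<open>W'\<close> differ by the mean over \<open>A\<close> of \<open>f(max A W) - f(max A W')\<close>, which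
  vanishes unless \<open>A < max W W'\<close>, an event of probability \<open>(max W W')\<^bsup>1-\<phi>\<^esup>\<close>. After Cauchy-Schwarz
  over \<open>A\<close>, this factor cancels the densities and leaves \<open>\<phi>\<close> times the mean of \<open>(f(S) - f(T))\<^sup>2\<close>
  for independent uniform \<open>S\<close>, \<open>T\<close>.

  The bound is approached by the indicators of \<open>X \<le> exp (- r/\<phi>)\<close> and \<open>Y \<le> exp (- r/\<psi>)\<close> as \<open>r \<rightarrow> 0\<close>.
\<close>

subsection \<open>Power laws on the unit interval\<close>

text \<open>The law with distribution function \<open>x\<^sup>p\<close> on \<open>[0,1]\<close>.\<close>

definition power_law :: "real \<Rightarrow> real measure" where
  "power_law p = (if p = 0 then return borel 0
     else density lborel (\<lambda>x. ennreal (p * x powr (p - 1)) * indicator {0..1} x))"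

lemma power_law_0: "power_law 0 = return borel 0"
  and power_law_density: "p \<noteq> 0 \<Longrightarrow>
    power_law p = density lborel (\<lambda>x. ennreal (p * x powr (p - 1)) * indicator {0..1} x)"
  by (simp_all add: power_law_def)

lemma sets_power_law [simp, measurable_cong]: "sets (power_law p) = sets borel"
  by (simp add: power_law_def)

lemma space_power_law [simp]: "space (power_law p) = UNIV"
  by (simp add: power_law_def)

lemma emeasure_power_law_atMost:
  assumes p: "0 \<le> p" and x: "0 < x \<or> p \<noteq> 0 \<and> 0 \<le> x"
  shows "emeasure (power_law p) {..x} = ennreal (min 1 x powr p)"
proof (cases "p = 0")
  case True
  with x have "0 < x" by simp
  then have "min 1 x powr 0 = 1" by simp
  then show ?thesis using \<open>0 < x\<close> unfolding True power_law_0 by (simp add: indicator_def)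
next
  case False
  with p have p: "p > 0" by simp
  define c where "c = min 1 x"
  have c: "0 \<le> c" using x by (auto simp: c_def)
  have hi: "((\<lambda>t. p * t powr (p - 1)) has_integral c powr p) {0..c}"
  proof -
    have "((\<lambda>t. p * t powr (p - 1)) has_integral p * (c powr (p - 1 + 1) / (p - 1 + 1))) {0..c}"
      using p c by (intro has_integral_mult_right has_integral_powr_from_0) auto
    then show ?thesis using p by simp
  qed
  have "emeasure (power_law p) {..x} =
      (\<integral>\<^sup>+t. ennreal (p * t powr (p - 1)) * indicator {0..1} t * indicator {..x} t \<partial>lborel)"
    using False by (simp add: power_law_def emeasure_density)
  also have "\<dots> = (\<integral>\<^sup>+t. ennreal (p * t powr (p - 1)) * indicator {0..c} t \<partial>lborel)"
    by (intro nn_integral_cong) (auto simp: c_def indicator_def)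
  also have "\<dots> = ennreal (c powr p)"
    by (rule nn_integral_has_integral_lebesgue'[OF _ hi]) (use p in auto)
  finally show ?thesis by (simp add: c_def)
qed

lemma emeasure_power_law_neg: "x < 0 \<Longrightarrow> emeasure (power_law p) {..x} = 0"
proof (cases "p = 0")
  case False
  assume x: "x < 0"
  have "(\<integral>\<^sup>+t. ennreal (p * t powr (p - 1)) * indicator {0..1} t * indicator {..x} t \<partial>lborel) =
      (\<integral>\<^sup>+t. 0 \<partial>(lborel :: real measure))"
    by (intro nn_integral_cong) (use x in \<open>auto split: split_indicator\<close>)
  then show ?thesis using False by (simp add: power_law_def emeasure_density)
qed (simp add: power_law_def)

lemma AE_power_law_bounds: "AE x in power_law p. 0 \<le> x \<and> x \<le> 1"
proof (cases "p = 0")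
  case True
  then show ?thesis unfolding True power_law_0 by (subst AE_return) auto
next
  case False
  show ?thesis unfolding power_law_density[OF False]
    by (subst AE_density) (auto simp: indicator_def)
qed

lemma prob_space_power_law:
  assumes p: "0 \<le> p" shows "prob_space (power_law p)"
proof
  have "emeasure (power_law p) (space (power_law p)) = emeasure (power_law p) {..1}"
    by (rule emeasure_eq_AE) (use AE_power_law_bounds[of p] in auto)
  then show "emeasure (power_law p) (space (power_law p)) = 1"
    using emeasure_power_law_atMost[OF p, of 1] by simp
qed

lemma AE_power_law_pos:
  assumes "0 < p" shows "AE x in power_law p. 0 < x \<and> x < 1"
proof -
  have "AE x in lborel. x \<noteq> (0::real)" "AE x in lborel. x \<noteq> (1::real)"
    by (rule AE_lborel_singleton)+
  then have "AE x in lborel. 0 < ennreal (p * x powr (p - 1)) * indicator {0..1} x \<longrightarrow> 0 < x \<and> x < 1"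
    by eventually_elim (auto simp: indicator_def)
  then show ?thesis using assms by (subst power_law_density, simp, subst AE_density) auto
qed

lemma measure_power_law_atMost:
  assumes "0 \<le> p" "0 < x \<or> p \<noteq> 0 \<and> 0 \<le> x"
  shows "measure (power_law p) {..x} = min 1 x powr p"
  using emeasure_power_law_atMost[OF assms] by (simp only: measure_def enn2real_ennreal powr_ge_zero)

lemma measure_power_law_nonpos:
  assumes "0 \<le> p" "x \<le> 0"
  shows "measure (power_law p) {..x} = (if p = 0 \<and> x = 0 then 1 else 0)"
proof (cases "x < 0")
  case True
  then show ?thesis using emeasure_power_law_neg[OF True] by (simp add: measure_def)
next
  case False
  then have x: "x = 0" using assms by simp
  show ?thesis
  proof (cases "p = 0")
    case True
    then show ?thesis by (simp add: x power_law_0 measure_def)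
  next
    case False
    then show ?thesis using measure_power_law_atMost[of p 0] assms by (simp add: x)
  qed
qed

lemma real_distribution_power_law: "0 \<le> p \<Longrightarrow> real_distribution (power_law p)"
  using prob_space_power_law[of p]
  by (simp add: real_distribution_def real_distribution_axioms_def)

text \<open>The weight cancels the power in the density and leaves the uniform law with the factor
  \<open>p\<close>. For \<open>p = 0\<close> both sides are 0, since the weight vanishes at the
  atom. This change of law produces every factor \<open>p\<close> and \<open>1 - p\<close> in the
  energy estimate.\<close>

lemma nn_integral_power_law_weight:
  assumes [measurable]: "g \<in> borel_measurable borel" and p: "0 \<le> p" "p \<le> 1"
  shows "(\<integral>\<^sup>+x. ennreal (x powr (1 - p)) * g x \<partial>power_law p) = ennreal p * (\<integral>\<^sup>+x. g x \<partial>power_law 1)"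
proof (cases "p = 0")
  case True
  then show ?thesis by (simp add: power_law_def nn_integral_return)
next
  case False
  have "(\<integral>\<^sup>+x. ennreal (x powr (1 - p)) * g x \<partial>power_law p) =
     (\<integral>\<^sup>+x. ennreal p * (ennreal (1 * x powr (1 - 1)) * indicator {0..1} x * g x) \<partial>lborel)"
  proof -
    have eq: "ennreal (p * x powr (p - 1)) * indicator {0..1} x * (ennreal (x powr (1 - p)) * g x) =
        ennreal p * (ennreal (1 * x powr (1 - 1)) * indicator {0..1} x * g x)" for x :: real
    proof -
      \<comment> \<open>The exponent stays in the form \<open>1 - 1\<close>: at \<open>x = 0\<close>
        this power is 0, not 1, and it has to agree literally with the density of
        \<open>power_law 1\<close>.\<close>
      have "x powr (p - 1) * x powr (1 - p) = x powr (1 - 1)"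
        using powr_add[of x "p - 1" "1 - p"] by simp
      then have "p * x powr (p - 1) * x powr (1 - p) = p * (1 * x powr (1 - 1))"
        by (simp only: mult.assoc mult_1)
      then have "ennreal (p * x powr (p - 1)) * ennreal (x powr (1 - p)) = ennreal p * ennreal (1 * x powr (1 - 1))"
        using p by (simp only: ennreal_mult[symmetric] mult_nonneg_nonneg powr_ge_zero zero_le_one)
      then show ?thesis by (simp only: mult_ac)
    qed
    show ?thesis
      unfolding power_law_density[OF False] by (subst nn_integral_density) (auto simp: eq)
  qed
  also have "\<dots> = ennreal p * (\<integral>\<^sup>+x. g x \<partial>power_law 1)"
    by (subst nn_integral_cmult, simp) (simp add: power_law_density nn_integral_density)
  finally show ?thesis .
qed

text \<open>The quantile function of \<^term>\<open>power_law p\<close>; the case distinction is needed because \<open>1 / 0 = 0\<close>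
  would turn it into the constant 1.\<close>

definition power_inv :: "real \<Rightarrow> real \<Rightarrow> real" where
  "power_inv p z = (if p = 0 then 0 else z powr (1 / p))"

lemma power_inv_measurable [measurable]: "power_inv p \<in> borel_measurable borel"
  unfolding power_inv_def by measurable

lemma power_inv_le_iff:
  assumes "0 \<le> p" "0 < x" "0 < z" "z < 1"
  shows "power_inv p z \<le> x \<longleftrightarrow> z \<le> min 1 x powr p"
proof (cases "p = 0")
  case False
  with assms have p: "p > 0" by simp
  have "z powr (1 / p) \<le> x \<longleftrightarrow> z powr (1 / p) \<le> min 1 x"
    using assms p powr_le1[of "1/p" z] by auto
  also have "\<dots> \<longleftrightarrow> (z powr (1 / p)) powr p \<le> min 1 x powr p"
    using assms p powr_mono2[of p "z powr (1 / p)" "min 1 x"] powr_less_mono2[of p "min 1 x" "z powr (1 / p)"]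
    by (meson less_imp_le linorder_not_less min.boundedI powr_ge_zero zero_le_one)
  finally show ?thesis using assms p by (simp add: power_inv_def powr_powr)
qed (use assms in \<open>simp add: power_inv_def\<close>)

lemma distr_power_inv:
  assumes p: "0 \<le> p"
  shows "distr (power_law 1) borel (power_inv p) = power_law p"
proof (rule cdf_unique)
  interpret prob_space "power_law 1" by (rule prob_space_power_law) simp
  show "real_distribution (distr (power_law 1) borel (power_inv p))"
    by (rule real_distribution_distr) measurable
  show "real_distribution (power_law p)" by (rule real_distribution_power_law[OF p])
  show "cdf (distr (power_law 1) borel (power_inv p)) = cdf (power_law p)"
  proof
    fix x
    have "cdf (distr (power_law 1) borel (power_inv p)) x = measure (power_law 1) {z. power_inv p z \<le> x}"
      by (simp add: cdf_def measure_distr vimage_def)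
    also have "\<dots> = measure (power_law p) {..x}"
    proof (cases "0 < x")
      case True
      have "measure (power_law 1) {z. power_inv p z \<le> x} = measure (power_law 1) {..min 1 x powr p}"
        by (rule finite_measure_eq_AE)
           (use AE_power_law_pos[of 1] power_inv_le_iff[OF p True] in auto)
      also have "\<dots> = measure (power_law p) {..x}"
        using p True measure_power_law_atMost[of 1 "min 1 x powr p"] measure_power_law_atMost[of p x]
        powr_le1[of p "min 1 x"]
        by simp
      finally show ?thesis .
    next
      case False
      have "\<not> z powr (1 / p) \<le> x" if "0 < z" for z
        using False that powr_gt_zero[of z "1 / p"] by linarith
      \<comment> \<open>For \<open>x \<le> 0\<close> and positive \<open>z\<close>, a positive
        \<open>p\<close> makes the quantile positive and the event empty. For \<open>p = 0\<close>
        the quantile is constantly 0, so the event is everything exactly when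
        \<open>x = 0\<close>.\<close>
      then have "AE z in power_law 1. power_inv p z \<le> x \<longleftrightarrow> z \<in> (if p = 0 \<and> x = 0 then UNIV else {})"
        using AE_power_law_pos[of 1, simplified] False
        by (auto elim!: eventually_mono simp: power_inv_def)
      then have "measure (power_law 1) {z. power_inv p z \<le> x} =
          measure (power_law 1) (if p = 0 \<and> x = 0 then UNIV else {})"
        by (intro finite_measure_eq_AE) auto
      then show ?thesis
        using False p prob_space by (simp add: measure_power_law_nonpos)
    qed
    finally show "cdf (distr (power_law 1) borel (power_inv p)) x = cdf (power_law p) x"
      by (simp add: cdf_def)
  qed
qed

subsection \<open>Second moments\<close>

lemma integrable_mult_of_squares:
  fixes F G :: "'a \<Rightarrow> real"
  assumes [measurable]: "F \<in> borel_measurable M" "G \<in> borel_measurable M"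
    and "integrable M (\<lambda>w. (F w)\<^sup>2)" "integrable M (\<lambda>w. (G w)\<^sup>2)"
  shows "integrable M (\<lambda>w. F w * G w)"
proof (rule Bochner_Integration.integrable_bound[of _ "\<lambda>w. (F w)\<^sup>2 + (G w)\<^sup>2"])
  have "\<bar>F w * G w\<bar> \<le> (F w)\<^sup>2 + (G w)\<^sup>2" for w
  proof -
    have "0 \<le> \<bar>F w\<bar> * \<bar>G w\<bar>" by simp
    then show ?thesis using sum_squares_bound[of "\<bar>F w\<bar>" "\<bar>G w\<bar>"] unfolding abs_mult power2_abs by linarith
  qed
  then show "AE w in M. norm (F w * G w) \<le> norm ((F w)\<^sup>2 + (G w)\<^sup>2)" by simp
qed (use assms in auto)

lemma integral_mult_square_le:
  fixes F G :: "'a \<Rightarrow> real"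
  assumes [measurable]: "F \<in> borel_measurable M" "G \<in> borel_measurable M"
    and F: "integrable M (\<lambda>w. (F w)\<^sup>2)" and G: "integrable M (\<lambda>w. (G w)\<^sup>2)"
  shows "(integral\<^sup>L M (\<lambda>w. F w * G w))\<^sup>2 \<le> integral\<^sup>L M (\<lambda>w. (F w)\<^sup>2) * integral\<^sup>L M (\<lambda>w. (G w)\<^sup>2)"
proof -
  define I S T where "I = integral\<^sup>L M (\<lambda>w. F w * G w)"
    and "S = integral\<^sup>L M (\<lambda>w. (F w)\<^sup>2)" and "T = integral\<^sup>L M (\<lambda>w. (G w)\<^sup>2)"
  note FG = integrable_mult_of_squares[OF assms]
  have *: "0 \<le> S - 2 * c * I + c\<^sup>2 * T" for c
  proof -
    have "0 \<le> integral\<^sup>L M (\<lambda>w. (F w - c * G w)\<^sup>2)" by simp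
    also have "\<dots> = integral\<^sup>L M (\<lambda>w. (F w)\<^sup>2 - 2 * c * (F w * G w) + c\<^sup>2 * (G w)\<^sup>2)"
      by (intro Bochner_Integration.integral_cong refl) (simp add: power2_diff power_mult_distrib)
    also have "\<dots> = S - 2 * c * I + c\<^sup>2 * T"
      using F G FG by (simp add: I_def S_def T_def)
    finally show ?thesis .
  qed
  have "I\<^sup>2 \<le> S * T"
  proof (cases "T = 0")
    case True
    have "I = 0"
    proof (rule ccontr)
      assume "I \<noteq> 0"
      \<comment> \<open>With \<open>T = 0\<close> the quadratic is affine in \<open>c\<close>; this
        choice of \<open>c\<close> gives it the value \<open>S - (S + 1) = -1\<close>.\<close>
      then show False using *[of "(S + 1) / (2 * I)"] True by simp
    qed
    then show ?thesis using True by simp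
  next
    case False
    moreover have "0 \<le> T" by (simp add: T_def)
    ultimately have "0 < T" by linarith
    \<comment> \<open>\<open>I / T\<close> is the minimiser of the quadratic in
      \<open>c\<close>.\<close>
    have "S - 2 * (I / T) * I + (I / T)\<^sup>2 * T = S - I\<^sup>2 / T"
      using \<open>0 < T\<close> by (simp add: power2_eq_square)
    with *[of "I / T"] have "I\<^sup>2 / T \<le> S" by linarith
    then show ?thesis using \<open>0 < T\<close> by (simp only: pos_divide_le_eq)
  qed
  then show ?thesis by (simp add: I_def S_def T_def)
qed

text \<open>Writing the variance through pairs of independent copies removes the mean, so a
  pointwise bound on squared differences integrates to a bound on variances. With nonnegative
  integrals the majorant needs no integrability check.\<close>

lemma (in prob_space) nn_integral_square_diff:
  fixes X :: "'a \<Rightarrow> real"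
  assumes [measurable]: "X \<in> borel_measurable M" and X2: "integrable M (\<lambda>w. (X w)\<^sup>2)"
  shows "(\<integral>\<^sup>+x. \<integral>\<^sup>+y. ennreal ((X x - X y)\<^sup>2) \<partial>M \<partial>M) = ennreal (2 * variance X)"
proof -
  have X: "integrable M X" by (rule square_integrable_imp_integrable) (use X2 in auto)
  have e: "((X x - X y)\<^sup>2) = (X x)\<^sup>2 - (2 * X x) * X y + (X y)\<^sup>2" for x y
    by (simp add: power2_diff)
  have 1: "(\<integral>\<^sup>+y. ennreal ((X x - X y)\<^sup>2) \<partial>M) =
      ennreal ((X x)\<^sup>2 - 2 * expectation X * X x + expectation (\<lambda>w. (X w)\<^sup>2))" for x
  proof (subst nn_integral_eq_integral)
    show "integrable M (\<lambda>y. (X x - X y)\<^sup>2)" unfolding e using X X2 by simp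
    have "expectation (\<lambda>y. (X x - X y)\<^sup>2) = (X x)\<^sup>2 - 2 * expectation X * X x + expectation (\<lambda>w. (X w)\<^sup>2)"
      unfolding e using X X2 by (simp add: prob_space)
    then show "ennreal (expectation (\<lambda>y. (X x - X y)\<^sup>2)) =
        ennreal ((X x)\<^sup>2 - 2 * expectation X * X x + expectation (\<lambda>w. (X w)\<^sup>2))" by simp
  qed auto
  have nn: "0 \<le> (X x)\<^sup>2 - 2 * expectation X * X x + expectation (\<lambda>w. (X w)\<^sup>2)" for x
  proof -
    have "(expectation X)\<^sup>2 \<le> expectation (\<lambda>w. (X w)\<^sup>2)"
      using variance_positive[of X] variance_eq[OF X X2] by linarith
    moreover have "0 \<le> (X x - expectation X)\<^sup>2" by simp
    ultimately show ?thesis by (simp add: power2_diff algebra_simps)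
  qed
  show ?thesis unfolding 1
  proof (subst nn_integral_eq_integral)
    show "integrable M (\<lambda>x. (X x)\<^sup>2 - 2 * expectation X * X x + expectation (\<lambda>w. (X w)\<^sup>2))"
      using X X2 by simp
    have "expectation (\<lambda>x. (X x)\<^sup>2 - 2 * expectation X * X x + expectation (\<lambda>w. (X w)\<^sup>2)) = 2 * variance X"
      using X X2 variance_eq[OF X X2] by (simp add: prob_space power2_eq_square)
    then show "ennreal (expectation (\<lambda>x. (X x)\<^sup>2 - 2 * expectation X * X x + expectation (\<lambda>w. (X w)\<^sup>2))) =
      ennreal (2 * variance X)" by simp
  qed (use nn in auto)
qed

lemma borel_measurable_indicator_lessThan [measurable]:
  fixes g h :: "'a \<Rightarrow> real"
  assumes [measurable]: "g \<in> borel_measurable N" "h \<in> borel_measurable N"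
  shows "(\<lambda>x. indicator {..<g x} (h x) :: ennreal) \<in> borel_measurable N"
  unfolding indicator_def lessThan_iff by measurable

text \<open>Swapping the variables by Fubini identifies the halves above and below the diagonal. The
  diagonal may carry mass, as for the atom of \<open>power_law 0\<close>, but \<open>K\<close>
  vanishes on it.\<close>

lemma nn_integral_symmetric_kernel:
  fixes K :: "real \<Rightarrow> real \<Rightarrow> ennreal"
  assumes "sigma_finite_measure M" and sets [measurable_cong]: "sets M = sets borel"
    and K [measurable]: "(\<lambda>(x, y). K x y) \<in> borel_measurable (borel \<Otimes>\<^sub>M borel)"
    and sym: "\<And>x y. K x y = K y x" and diag: "\<And>x. K x x = 0"
  shows "(\<integral>\<^sup>+x. \<integral>\<^sup>+y. K x y \<partial>M \<partial>M) = 2 * (\<integral>\<^sup>+x. \<integral>\<^sup>+y. indicator {..<x} y * K x y \<partial>M \<partial>M)"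
proof -
  interpret sigma_finite_measure M by fact
  interpret P: pair_sigma_finite M M ..
  have [measurable]: "(\<lambda>x. K (g x) (h x)) \<in> borel_measurable N"
    if "g \<in> borel_measurable N" "h \<in> borel_measurable N" for g h and N :: "real measure"
    using measurable_compose[OF measurable_Pair[OF that] K] by simp
  have [measurable]: "(\<lambda>x. K (g x) (h x)) \<in> borel_measurable N"
    if "g \<in> borel_measurable N" "h \<in> borel_measurable N" for g h and N :: "(real \<times> real) measure"
    using measurable_compose[OF measurable_Pair[OF that] K] by simp
  have eq: "K x y = indicator {..<x} y * K x y + indicator {..<y} x * K y x" for x y
    using sym[of x y] diag[of x] by (cases x y rule: linorder_cases) auto
  have "(\<integral>\<^sup>+x. \<integral>\<^sup>+y. K x y \<partial>M \<partial>M) =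
      (\<integral>\<^sup>+x. \<integral>\<^sup>+y. indicator {..<x} y * K x y + indicator {..<y} x * K y x \<partial>M \<partial>M)"
    by (intro nn_integral_cong eq)
  also have "\<dots> = (\<integral>\<^sup>+x. \<integral>\<^sup>+y. indicator {..<x} y * K x y \<partial>M \<partial>M) +
      (\<integral>\<^sup>+x. \<integral>\<^sup>+y. indicator {..<y} x * K y x \<partial>M \<partial>M)"
    by (subst nn_integral_add[symmetric], measurable)
       (intro nn_integral_cong nn_integral_add; measurable)
  also have "(\<integral>\<^sup>+x. \<integral>\<^sup>+y. indicator {..<y} x * K y x \<partial>M \<partial>M) =
      (\<integral>\<^sup>+y. \<integral>\<^sup>+x. indicator {..<y} x * K y x \<partial>M \<partial>M)"
    by (rule P.Fubini') measurable
  finally show ?thesis by (simp add: mult_2)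
qed

lemma (in prob_space) covariance_eq:
  assumes X: "integrable M X" and Y: "integrable M Y" and XY: "integrable M (\<lambda>w. X w * Y w)"
  shows "covariance M X Y = expectation (\<lambda>w. X w * Y w) - expectation X * expectation Y"
proof -
  have "covariance M X Y = expectation (\<lambda>w. X w * Y w - expectation Y * X w - expectation X * Y w +
      expectation X * expectation Y)"
    unfolding covariance_def by (intro Bochner_Integration.integral_cong refl) (simp add: algebra_simps)
  also have "\<dots> = expectation (\<lambda>w. X w * Y w) - expectation X * expectation Y"
    using X Y XY by (simp add: prob_space)
  finally show ?thesis .
qed

lemma (in prob_space) covariance_le:
  fixes X Y :: "'a \<Rightarrow> real"
  assumes [measurable]: "X \<in> borel_measurable M" "Y \<in> borel_measurable M"
    and X2: "integrable M (\<lambda>w. (X w)\<^sup>2)" and Y2: "integrable M (\<lambda>w. (Y w)\<^sup>2)"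
  shows "covariance M X Y \<le> sqrt (variance X * variance Y)"
proof (rule real_le_rsqrt)
  have i: "integrable M (\<lambda>w. (Z w - c)\<^sup>2)"
    if [measurable]: "Z \<in> borel_measurable M" and Z2: "integrable M (\<lambda>w. (Z w)\<^sup>2)" for Z :: "'a \<Rightarrow> real" and c
  proof -
    have "integrable M Z" by (rule square_integrable_imp_integrable[OF _ Z2]) simp
    then show ?thesis using Z2 by (simp add: power2_diff)
  qed
  show "(covariance M X Y)\<^sup>2 \<le> variance X * variance Y"
    unfolding covariance_def by (rule integral_mult_square_le) (use X2 Y2 i in auto)
qed

subsection \<open>The maximum of two independent power-law variables\<close>

text \<open>The bound fails at \<open>y = 0\<close> when \<open>p = 1\<close>, where the left side
  is the full atom and the right side is \<open>0 powr 0 = 0\<close>. That point is a null set of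
  \<open>power_law 1\<close>.\<close>

lemma AE_emeasure_power_law_atMost_le:
  assumes p: "0 \<le> p" "p \<le> 1"
  shows "AE y in power_law p. emeasure (power_law (1 - p)) {..y} \<le> ennreal (y powr (1 - p))"
proof -
  have "AE y in power_law p. 0 \<le> y \<and> y \<le> 1 \<and> (0 < p \<longrightarrow> 0 < y)"
    using AE_power_law_bounds[of p] AE_power_law_pos[of p] p by (cases "0 < p") auto
  then show ?thesis
  proof eventually_elim
    case (elim y)
    then have "0 < y \<or> 1 - p \<noteq> 0 \<and> 0 \<le> y" using p by linarith
    moreover have "min 1 y = y" using elim by simp
    ultimately show ?case using emeasure_power_law_atMost[of "1 - p" y] p by simp
  qed
qed

text \<open>By symmetry it suffices to treat \<open>y < x\<close>. The inner integrand then equals \<open>(f x - f y)\<^sup>2\<close> for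
  \<open>a \<le> y\<close>, equals \<open>(f x - f a)\<^sup>2\<close> for \<open>y < a < x\<close>, and vanishes for \<open>a \<ge> x\<close>. Integrating out the
  variable that does not occur produces exactly the weight that makes the remaining law uniform,
  and the two parts contribute \<open>p\<close> and \<open>1 - p\<close> times the same integral.\<close>

lemma max_coupling_energy_le:
  fixes f :: "real \<Rightarrow> real"
  assumes f [measurable]: "f \<in> borel_measurable borel" and p: "0 \<le> p" "p \<le> 1"
  shows "(\<integral>\<^sup>+x. \<integral>\<^sup>+y. ennreal (max x y powr (1 - p)) *
        (\<integral>\<^sup>+a. ennreal ((f (max a x) - f (max a y))\<^sup>2) \<partial>power_law (1 - p))
        \<partial>power_law p \<partial>power_law p)
      \<le> ennreal p * (\<integral>\<^sup>+s. \<integral>\<^sup>+t. ennreal ((f s - f t)\<^sup>2) \<partial>power_law 1 \<partial>power_law 1)"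
proof -
  define U W A where "U = power_law 1" and "W = power_law p" and "A = power_law (1 - p)"
  have [measurable_cong]: "sets U = sets borel" "sets W = sets borel" "sets A = sets borel"
    by (simp_all add: U_def W_def A_def)
  interpret U: prob_space U unfolding U_def by (rule prob_space_power_law) simp
  interpret W: prob_space W unfolding W_def by (rule prob_space_power_law[OF p(1)])
  interpret A: prob_space A unfolding A_def by (rule prob_space_power_law) (use p in simp)
  interpret AW: pair_sigma_finite A W ..
  define d where "d x y = ennreal ((f x - f y)\<^sup>2)" for x y
  have [measurable]: "(\<lambda>x. d (g x) (h x)) \<in> borel_measurable N"
    if [measurable]: "g \<in> borel_measurable N" "h \<in> borel_measurable N" for g h and N :: "'b measure"
    unfolding d_def by measurable
  have d_sym: "d x y = d y x" and d_diag: "d x x = 0" for x y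
    by (simp_all add: d_def power2_commute)
  define K where "K x y = ennreal (max x y powr (1 - p)) * (\<integral>\<^sup>+a. d (max a x) (max a y) \<partial>A)" for x y
  \<comment> \<open>\<open>G x\<close> is the part \<open>y < x\<close> of the coupled energy,
    stripped of the outer weight, which depends only on \<open>x\<close> there. \<open>H x\<close>
    is its uniform counterpart, and the goal is \<open>G x \<le> H x\<close>.\<close>
  define H where "H x = (\<integral>\<^sup>+y. indicator {..<x} y * d x y \<partial>U)" for x
  define G where "G x = (\<integral>\<^sup>+y. indicator {..<x} y * (\<integral>\<^sup>+a. d (max a x) (max a y) \<partial>A) \<partial>W)" for x
  have [measurable]: "(\<lambda>y. emeasure A {..y}) \<in> borel_measurable borel"
  proof -
    have "(\<lambda>y. \<integral>\<^sup>+a. indicator {a. a \<le> y} a \<partial>A) \<in> borel_measurable borel"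
      unfolding indicator_def mem_Collect_eq by measurable
    then show ?thesis by (simp add: atMost_def)
  qed
  have H_meas [measurable]: "H \<in> borel_measurable borel" unfolding H_def by measurable
  have G_meas [measurable]: "G \<in> borel_measurable borel" unfolding G_def by measurable
  have G_le: "G x \<le> H x" for x
  proof -
    have split: "indicator {..<x} y * (\<integral>\<^sup>+a. d (max a x) (max a y) \<partial>A) =
        emeasure A {..y} * (indicator {..<x} y * d x y) +
        (\<integral>\<^sup>+a. indicator {..<a} y * (indicator {..<x} a * d x a) \<partial>A)" for y
    proof -
      have "indicator {..<x} y * (\<integral>\<^sup>+a. d (max a x) (max a y) \<partial>A) =
          (\<integral>\<^sup>+a. indicator {..<x} y * d (max a x) (max a y) \<partial>A)"
        by (simp add: nn_integral_cmult)
      also have "\<dots> = (\<integral>\<^sup>+a. (indicator {..<x} y * d x y) * indicator {..y} a +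
          indicator {..<a} y * (indicator {..<x} a * d x a) \<partial>A)"
        by (intro nn_integral_cong) (auto simp: indicator_def d_diag max_def)
      also have "\<dots> = (indicator {..<x} y * d x y) * emeasure A {..y} +
          (\<integral>\<^sup>+a. indicator {..<a} y * (indicator {..<x} a * d x a) \<partial>A)"
        by (subst nn_integral_add) (auto simp: nn_integral_cmult_indicator)
      finally show ?thesis by (simp add: mult.commute)
    qed
    have "G x = (\<integral>\<^sup>+y. emeasure A {..y} * (indicator {..<x} y * d x y) \<partial>W) +
        (\<integral>\<^sup>+y. \<integral>\<^sup>+a. indicator {..<a} y * (indicator {..<x} a * d x a) \<partial>A \<partial>W)"
      unfolding G_def split by (rule nn_integral_add; measurable)
    also have "(\<integral>\<^sup>+y. \<integral>\<^sup>+a. indicator {..<a} y * (indicator {..<x} a * d x a) \<partial>A \<partial>W) =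
        (\<integral>\<^sup>+a. \<integral>\<^sup>+y. indicator {..<a} y * (indicator {..<x} a * d x a) \<partial>W \<partial>A)"
      by (rule AW.Fubini') measurable
    also have "\<dots> = (\<integral>\<^sup>+a. emeasure W {..<a} * (indicator {..<x} a * d x a) \<partial>A)"
    proof (intro nn_integral_cong)
      fix a
      have "(\<integral>\<^sup>+y. indicator {..<a} y * (indicator {..<x} a * d x a) \<partial>W) =
          (\<integral>\<^sup>+y. (indicator {..<x} a * d x a) * indicator {..<a} y \<partial>W)"
        by (simp add: mult.commute)
      also have "\<dots> = (indicator {..<x} a * d x a) * emeasure W {..<a}"
        by (rule nn_integral_cmult_indicator) simp
      finally show "(\<integral>\<^sup>+y. indicator {..<a} y * (indicator {..<x} a * d x a) \<partial>W) =
          emeasure W {..<a} * (indicator {..<x} a * d x a)"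
        by (simp add: mult.commute)
    qed
    \<comment> \<open>Integrating out \<open>y\<close> has left the mass of \<open>W\<close> below
      \<open>a\<close>, at most \<open>a powr p\<close>. The exponent is written as
      \<open>1 - (1 - p)\<close> because it is the weight belonging to the law \<open>A\<close> with
      parameter \<open>1 - p\<close>.\<close>
    also have "\<dots> \<le> (\<integral>\<^sup>+a. ennreal (a powr (1 - (1 - p))) * (indicator {..<x} a * d x a) \<partial>A)"
    proof (rule nn_integral_mono_AE)
      have "AE a in A. emeasure W {..a} \<le> ennreal (a powr (1 - (1 - p)))"
        unfolding W_def A_def using AE_emeasure_power_law_atMost_le[of "1 - p"] p by simp
      then show "AE a in A. emeasure W {..<a} * (indicator {..<x} a * d x a) \<le>
          ennreal (a powr (1 - (1 - p))) * (indicator {..<x} a * d x a)"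
      proof eventually_elim
        case (elim a)
        have "emeasure W {..<a} \<le> emeasure W {..a}" by (rule emeasure_mono) auto
        with elim show ?case by (intro mult_right_mono) auto
      qed
    qed
    also have "\<dots> = ennreal (1 - p) * H x"
      unfolding A_def H_def U_def by (rule nn_integral_power_law_weight) (use p in auto)
    also have "(\<integral>\<^sup>+y. emeasure A {..y} * (indicator {..<x} y * d x y) \<partial>W) \<le>
        (\<integral>\<^sup>+y. ennreal (y powr (1 - p)) * (indicator {..<x} y * d x y) \<partial>W)"
      using AE_emeasure_power_law_atMost_le[OF p] unfolding A_def[symmetric] W_def[symmetric]
      by (intro nn_integral_mono_AE) (auto intro!: mult_right_mono elim!: eventually_mono)
    also have "\<dots> = ennreal p * H x"
      unfolding W_def H_def U_def by (rule nn_integral_power_law_weight) (use p in auto)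
    also have "ennreal p * H x + ennreal (1 - p) * H x = H x"
      using p by (simp add: distrib_right[symmetric] ennreal_plus[symmetric] del: ennreal_plus)
    finally show ?thesis by (simp add: add_mono)
  qed
  have "(\<integral>\<^sup>+x. \<integral>\<^sup>+y. K x y \<partial>W \<partial>W) = 2 * (\<integral>\<^sup>+x. \<integral>\<^sup>+y. indicator {..<x} y * K x y \<partial>W \<partial>W)"
  proof (rule nn_integral_symmetric_kernel)
    show "(\<lambda>(x, y). K x y) \<in> borel_measurable (borel \<Otimes>\<^sub>M borel)" unfolding K_def by measurable
    show "K x y = K y x" for x y unfolding K_def by (simp add: max.commute d_sym[of "max _ x"])
    show "K x x = 0" for x unfolding K_def by (simp add: d_diag)
  qed (auto simp: W_def intro: W.sigma_finite_measure_axioms[unfolded W_def])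
  also have "(\<integral>\<^sup>+x. \<integral>\<^sup>+y. indicator {..<x} y * K x y \<partial>W \<partial>W) = (\<integral>\<^sup>+x. ennreal (x powr (1 - p)) * G x \<partial>W)"
  proof (intro nn_integral_cong)
    fix x
    have "indicator {..<x} y * K x y = ennreal (x powr (1 - p)) *
        (indicator {..<x} y * (\<integral>\<^sup>+a. d (max a x) (max a y) \<partial>A))" for y
      by (auto simp: K_def indicator_def max_def)
    then show "(\<integral>\<^sup>+y. indicator {..<x} y * K x y \<partial>W) = ennreal (x powr (1 - p)) * G x"
      unfolding G_def by (simp add: nn_integral_cmult)
  qed
  \<comment> \<open>The factor \<open>p\<close> of the conclusion arises here: the outer weight
    turns the law of \<open>x\<close> into the uniform law.\<close>
  also have "\<dots> = ennreal p * (\<integral>\<^sup>+x. G x \<partial>U)"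
    unfolding W_def U_def by (rule nn_integral_power_law_weight) (use p G_meas in auto)
  also have "2 * \<dots> \<le> 2 * (ennreal p * (\<integral>\<^sup>+x. H x \<partial>U))"
    by (intro mult_left_mono nn_integral_mono G_le) auto
  also have "\<dots> = ennreal p * (2 * (\<integral>\<^sup>+x. H x \<partial>U))" by (simp add: mult_ac)
  also have "2 * (\<integral>\<^sup>+x. H x \<partial>U) = (\<integral>\<^sup>+s. \<integral>\<^sup>+t. d s t \<partial>U \<partial>U)"
    unfolding H_def
    by (rule nn_integral_symmetric_kernel[symmetric])
       (auto simp: d_diag U_def intro: d_sym U.sigma_finite_measure_axioms[unfolded U_def])
  finally show ?thesis by (simp add: K_def d_def U_def W_def A_def)
qed

section \<open>The uniform law as the law of a maximum\<close>

text \<open>For positive \<open>u\<close> the exponents add up to 1. At \<open>u = 0\<close> the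
  product vanishes because \<open>p\<close> and \<open>1 - p\<close> are not both 0, so at most one
  factor has an atom there.\<close>

lemma measure_power_law_atMost_mult:
  assumes p: "0 \<le> p" "p \<le> 1"
  shows "measure (power_law p) {..u} * measure (power_law (1 - p)) {..u} = measure (power_law 1) {..u}"
proof (cases "0 < u")
  case True
  have "min 1 u powr p * min 1 u powr (1 - p) = min 1 u powr 1"
    using powr_add[of "min 1 u" p "1 - p"] by simp
  then show ?thesis
    using True p by (simp only: measure_power_law_atMost diff_ge_0_iff_ge zero_le_one simp_thms)
next
  case False
  then show ?thesis using p by (simp add: measure_power_law_nonpos)
qed

text \<open>The distribution function of a maximum of independent variables is the product of their
  distribution functions.\<close>

lemma distr_max_power_law:
  assumes p: "0 \<le> p" "p \<le> 1"
  shows "distr (power_law p \<Otimes>\<^sub>M power_law (1 - p)) borel (\<lambda>(x, a). max a x) = power_law 1"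
proof (rule cdf_unique)
  interpret W: prob_space "power_law p" by (rule prob_space_power_law[OF p(1)])
  interpret A: prob_space "power_law (1 - p)" by (rule prob_space_power_law) (use p in simp)
  interpret WA: pair_prob_space "power_law p" "power_law (1 - p)" ..
  show "real_distribution (distr (power_law p \<Otimes>\<^sub>M power_law (1 - p)) borel (\<lambda>(x, a). max a x))"
    by (rule WA.real_distribution_distr) measurable
  show "real_distribution (power_law 1)" by (rule real_distribution_power_law) simp
  show "cdf (distr (power_law p \<Otimes>\<^sub>M power_law (1 - p)) borel (\<lambda>(x, a). max a x)) = cdf (power_law 1)"
  proof
    fix u
    have "(\<lambda>(x, a). max a x) -` {..u} \<inter> space (power_law p \<Otimes>\<^sub>M power_law (1 - p)) = {..u} \<times> {..u}"
      by (auto simp: space_pair_measure)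
    then have "cdf (distr (power_law p \<Otimes>\<^sub>M power_law (1 - p)) borel (\<lambda>(x, a). max a x)) u =
        measure (power_law p \<Otimes>\<^sub>M power_law (1 - p)) ({..u} \<times> {..u})"
      unfolding cdf_def by (subst measure_distr) auto
    also have "\<dots> = measure (power_law p) {..u} * measure (power_law (1 - p)) {..u}"
      by (simp add: measure_def A.emeasure_pair_measure_Times enn2real_mult)
    also have "\<dots> = measure (power_law 1) {..u}"
      by (rule measure_power_law_atMost_mult[OF p])
    finally show "cdf (distr (power_law p \<Otimes>\<^sub>M power_law (1 - p)) borel (\<lambda>(x, a). max a x)) u = cdf (power_law 1) u"
      by (simp add: cdf_def)
  qed
qed

text \<open>If \<open>A\<close> and \<open>W\<close> are independent with laws \<^term>\<open>power_law (1 - p)\<close> and \<^term>\<open>power_law p\<close>,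
  this is the conditional expectation of \<open>f (max A W)\<close> given \<open>W = x\<close>.\<close>

definition max_cond :: "real \<Rightarrow> (real \<Rightarrow> real) \<Rightarrow> real \<Rightarrow> real" where
  "max_cond p f x = (\<integral>a. f (max a x) \<partial>power_law (1 - p))"

lemma max_cond_measurable [measurable]:
  assumes [measurable]: "f \<in> borel_measurable borel" and p: "p \<le> 1"
  shows "max_cond p f \<in> borel_measurable borel"
proof -
  interpret A: prob_space "power_law (1 - p)" by (rule prob_space_power_law) (use p in simp)
  show ?thesis unfolding max_cond_def by measurable
qed

text \<open>Fubini on the product of the two power laws, after transporting \<open>h\<close> along
  \<open>distr_max_power_law\<close>; the last claim is the tower property.\<close>

lemma max_power_law_integral:
  fixes h :: "real \<Rightarrow> real"
  assumes p: "0 \<le> p" "p \<le> 1" and h: "integrable (power_law 1) h"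
  shows "AE x in power_law p. integrable (power_law (1 - p)) (\<lambda>a. h (max a x))"
    and "integrable (power_law p) (max_cond p h)"
    and "integral\<^sup>L (power_law p) (max_cond p h) = integral\<^sup>L (power_law 1) h"
proof -
  interpret W: prob_space "power_law p" by (rule prob_space_power_law[OF p(1)])
  interpret A: prob_space "power_law (1 - p)" by (rule prob_space_power_law) (use p in simp)
  interpret WA: pair_prob_space "power_law p" "power_law (1 - p)" ..
  have [measurable]: "h \<in> borel_measurable borel" using h by (auto dest: borel_measurable_integrable)
  have m [measurable]: "(\<lambda>(x, a). max a x) \<in> power_law p \<Otimes>\<^sub>M power_law (1 - p) \<rightarrow>\<^sub>M (borel :: real measure)"
    by measurable
  have i: "integrable (power_law p \<Otimes>\<^sub>M power_law (1 - p)) (\<lambda>(x, a). h (max a x))"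
    using h unfolding distr_max_power_law[OF p, symmetric]
    by (subst (asm) integrable_distr_eq) (auto simp: split_beta')
  show "AE x in power_law p. integrable (power_law (1 - p)) (\<lambda>a. h (max a x))"
    using WA.AE_integrable_fst'[OF i] by simp
  show "integrable (power_law p) (max_cond p h)"
    unfolding max_cond_def using WA.integrable_fst'[OF i] by simp
  have "integral\<^sup>L (power_law 1) h = integral\<^sup>L (power_law p \<Otimes>\<^sub>M power_law (1 - p)) (\<lambda>(x, a). h (max a x))"
    unfolding distr_max_power_law[OF p, symmetric] by (subst integral_distr) (auto simp: split_beta')
  then show "integral\<^sup>L (power_law p) (max_cond p h) = integral\<^sup>L (power_law 1) h"
    unfolding max_cond_def using WA.integral_fst'[OF i] by simp
qed

section \<open>Variance contraction under conditioning\<close>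

text \<open>Square integrability is Jensen's inequality, read off from the nonnegativity of the
  variance over \<open>A\<close>. For the contraction, squared differences are compared pointwise
  and then integrated with \<open>max_coupling_energy_le\<close>.\<close>

lemma
  fixes f :: "real \<Rightarrow> real"
  assumes f [measurable]: "f \<in> borel_measurable borel" and p: "0 \<le> p" "p \<le> 1"
    and f2: "integrable (power_law 1) (\<lambda>x. (f x)\<^sup>2)"
  shows max_cond_square_integrable: "integrable (power_law p) (\<lambda>x. (max_cond p f x)\<^sup>2)"
    and variance_max_cond_le: "prob_space.variance (power_law p) (max_cond p f)
      \<le> p * prob_space.variance (power_law 1) f"
proof -
  define U W A where "U = power_law 1" and "W = power_law p" and "A = power_law (1 - p)"
  have [measurable_cong]: "sets U = sets borel" "sets W = sets borel" "sets A = sets borel"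
    by (simp_all add: U_def W_def A_def)
  interpret U: prob_space U unfolding U_def by (rule prob_space_power_law) simp
  interpret W: prob_space W unfolding W_def by (rule prob_space_power_law[OF p(1)])
  interpret A: prob_space A unfolding A_def by (rule prob_space_power_law) (use p in simp)
  have F [measurable]: "max_cond p f \<in> borel_measurable borel" by (rule max_cond_measurable[OF f p(2)])
  have int: "AE x in W. integrable A (\<lambda>a. (f (max a x))\<^sup>2)"
    unfolding W_def A_def by (rule max_power_law_integral[OF p f2])
  have int1: "integrable A (\<lambda>a. f (max a x))" if "integrable A (\<lambda>a. (f (max a x))\<^sup>2)" for x
    by (rule A.square_integrable_imp_integrable[OF _ that]) measurable
  show F2: "integrable (power_law p) (\<lambda>x. (max_cond p f x)\<^sup>2)"
  proof (rule Bochner_Integration.integrable_bound[OF max_power_law_integral(2)[OF p f2]])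
    show "AE x in power_law p. norm ((max_cond p f x)\<^sup>2) \<le> norm (max_cond p (\<lambda>x. (f x)\<^sup>2) x)"
      using int unfolding W_def[symmetric]
    proof eventually_elim
      case (elim x)
      have "0 \<le> A.expectation (\<lambda>a. (f (max a x))\<^sup>2) - (A.expectation (\<lambda>a. f (max a x)))\<^sup>2"
        using A.variance_eq[OF int1[OF elim] elim] A.variance_positive[of "\<lambda>a. f (max a x)"] by linarith
      then show ?case by (simp add: max_cond_def A_def)
    qed
  qed measurable
  have key: "AE x in W. AE y in W. ennreal ((max_cond p f x - max_cond p f y)\<^sup>2) \<le>
      ennreal (max x y powr (1 - p)) * (\<integral>\<^sup>+a. ennreal ((f (max a x) - f (max a y))\<^sup>2) \<partial>A)"
  proof -
    \<comment> \<open>Both requirements concern a single point, so the estimate can be proved for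
      all pairs of good points, without handling null sets in the plane.\<close>
    define good where "good x \<longleftrightarrow> integrable A (\<lambda>a. (f (max a x))\<^sup>2) \<and>
      emeasure A {..x} \<le> ennreal (x powr (1 - p))" for x
    have "AE x in W. emeasure A {..x} \<le> ennreal (x powr (1 - p))"
      unfolding W_def A_def by (rule AE_emeasure_power_law_atMost_le[OF p])
    with int have good: "AE x in W. good x" unfolding good_def by eventually_elim simp
    have "ennreal ((max_cond p f x - max_cond p f y)\<^sup>2) \<le>
      ennreal (max x y powr (1 - p)) * (\<integral>\<^sup>+a. ennreal ((f (max a x) - f (max a y))\<^sup>2) \<partial>A)"
      if x: "good x" and y: "good y" for x y
    proof -
      define m where "m = max x y"
      have m: "emeasure A {..m} \<le> ennreal (m powr (1 - p))"
        using x y by (cases "x \<le> y") (auto simp: m_def good_def max_def)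
      define D where "D a = f (max a x) - f (max a y)" for a
      have [measurable]: "D \<in> borel_measurable A" unfolding D_def by measurable
      have ix: "integrable A (\<lambda>a. (f (max a x))\<^sup>2)" and iy: "integrable A (\<lambda>a. (f (max a y))\<^sup>2)"
        using x y by (auto simp: good_def)
      have D2: "integrable A (\<lambda>a. (D a)\<^sup>2)"
      proof -
        have "integrable A (\<lambda>a. f (max a x) * f (max a y))"
          by (rule integrable_mult_of_squares[OF _ _ ix iy]) measurable
        then have "integrable A (\<lambda>a. (f (max a x))\<^sup>2 - 2 * (f (max a x) * f (max a y)) + (f (max a y))\<^sup>2)"
          using ix iy by simp
        then show ?thesis by (simp add: D_def power2_diff mult.assoc algebra_simps)
      qed
      have sq: "(indicat_real {..m} a)\<^sup>2 = indicat_real {..m} a" for a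
        by (simp add: indicator_def)
      have "max_cond p f x - max_cond p f y = A.expectation D"
        unfolding max_cond_def D_def A_def[symmetric] using int1[OF ix] int1[OF iy] by simp
      \<comment> \<open>Beyond \<open>m\<close> both maxima equal \<open>a\<close>, so
        \<open>D\<close> vanishes there. Inserting the indicator lets Cauchy-Schwarz produce the
        factor \<open>measure A {..m}\<close>.\<close>
      also have "A.expectation D = A.expectation (\<lambda>a. indicator {..m} a * D a)"
        by (intro Bochner_Integration.integral_cong refl) (auto simp: D_def m_def indicator_def)
      finally have "(max_cond p f x - max_cond p f y)\<^sup>2 =
          (A.expectation (\<lambda>a. indicator {..m} a * D a))\<^sup>2" by simp
      also have "\<dots> \<le> A.expectation (\<lambda>a. (indicator {..m} a)\<^sup>2) * A.expectation (\<lambda>a. (D a)\<^sup>2)"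
      proof (rule integral_mult_square_le[OF _ _ _ D2])
        show "integrable A (\<lambda>a. (indicat_real {..m} a)\<^sup>2)"
          unfolding sq by (rule integrable_real_indicator) (auto simp: A_def[symmetric] A.emeasure_eq_measure)
      qed measurable
      also have "A.expectation (\<lambda>a. (indicator {..m} a)\<^sup>2) = measure A {..m}"
        unfolding sq by (simp add: A_def)
      finally have "ennreal ((max_cond p f x - max_cond p f y)\<^sup>2) \<le>
          ennreal (measure A {..m}) * ennreal (A.expectation (\<lambda>a. (D a)\<^sup>2))"
        by (simp add: ennreal_leI flip: ennreal_mult)
      also have "\<dots> \<le> ennreal (m powr (1 - p)) * ennreal (A.expectation (\<lambda>a. (D a)\<^sup>2))"
        using m by (intro mult_right_mono) (simp_all add: A.emeasure_eq_measure)
      also have "ennreal (A.expectation (\<lambda>a. (D a)\<^sup>2)) = (\<integral>\<^sup>+a. ennreal ((D a)\<^sup>2) \<partial>A)"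
        by (rule nn_integral_eq_integral[symmetric]) (use D2 in auto)
      finally show ?thesis by (simp add: m_def D_def)
    qed
    then show ?thesis by (intro eventually_mono[OF good])
  qed
  have "ennreal (2 * W.variance (max_cond p f)) =
      (\<integral>\<^sup>+x. \<integral>\<^sup>+y. ennreal ((max_cond p f x - max_cond p f y)\<^sup>2) \<partial>W \<partial>W)"
    by (rule W.nn_integral_square_diff[symmetric]) (use F2 in \<open>simp_all add: W_def\<close>)
  also have "\<dots> \<le> (\<integral>\<^sup>+x. \<integral>\<^sup>+y. ennreal (max x y powr (1 - p)) *
      (\<integral>\<^sup>+a. ennreal ((f (max a x) - f (max a y))\<^sup>2) \<partial>A) \<partial>W \<partial>W)"
    using key by (intro nn_integral_mono_AE) (auto elim!: eventually_mono intro!: nn_integral_mono_AE)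
  also have "\<dots> \<le> ennreal p * (\<integral>\<^sup>+s. \<integral>\<^sup>+t. ennreal ((f s - f t)\<^sup>2) \<partial>U \<partial>U)"
    unfolding W_def A_def U_def by (rule max_coupling_energy_le[OF f p])
  also have "\<dots> = ennreal p * ennreal (2 * U.variance f)"
    by (subst U.nn_integral_square_diff) (use f2 in \<open>simp_all add: U_def\<close>)
  also have "\<dots> = ennreal (2 * (p * U.variance f))"
    using p by (simp add: mult_ac flip: ennreal_mult)
  finally have "2 * W.variance (max_cond p f) \<le> 2 * (p * U.variance f)"
    using p U.variance_positive[of f] by (subst (asm) ennreal_le_iff) auto
  then show "prob_space.variance (power_law p) (max_cond p f)
      \<le> p * prob_space.variance (power_law 1) f"
    by (simp add: W_def U_def)
qed

subsection \<open>A random vector with the Marshall-Olkin cdf\<close>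

text \<open>The common variable \<open>z\<close> models the simultaneous shock, \<open>a\<close> and \<open>b\<close> the individual ones.\<close>

definition mo_space :: "real \<Rightarrow> real \<Rightarrow> (real \<times> real \<times> real) measure" where
  "mo_space \<phi> \<psi> = power_law 1 \<Otimes>\<^sub>M (power_law (1 - \<phi>) \<Otimes>\<^sub>M power_law (1 - \<psi>))"

definition mo_fst :: "real \<Rightarrow> real \<times> real \<times> real \<Rightarrow> real" where
  "mo_fst \<phi> = (\<lambda>(z, a, b). max a (power_inv \<phi> z))"

definition mo_snd :: "real \<Rightarrow> real \<times> real \<times> real \<Rightarrow> real" where
  "mo_snd \<psi> = (\<lambda>(z, a, b). max b (power_inv \<psi> z))"

lemma measure_power_inv_le:
  assumes "0 \<le> p"
  shows "measure (power_law 1) {z. power_inv p z \<le> x} = measure (power_law p) {..x}"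
  unfolding distr_power_inv[OF assms, symmetric] by (subst measure_distr) (auto simp: vimage_def)

text \<open>Both conditions bound the same \<open>z\<close> from above, so the smaller threshold
  decides. This is the source of the minimum in the copula.\<close>

lemma measure_power_inv_le_both:
  assumes "0 \<le> p" "p \<le> 1" "0 \<le> q" "q \<le> 1" "0 < x" "0 < y"
  shows "measure (power_law 1) {z. power_inv p z \<le> x \<and> power_inv q z \<le> y} =
    min (min 1 x powr p) (min 1 y powr q)"
proof -
  interpret prob_space "power_law 1" by (rule prob_space_power_law) simp
  define m where "m = min (min 1 x powr p) (min 1 y powr q)"
  have m: "0 \<le> m" "m \<le> 1"
    using powr_le1[of p "min 1 x"] assms by (auto simp: m_def)
  have "AE z in power_law 1. z \<in> {z. power_inv p z \<le> x \<and> power_inv q z \<le> y} \<longleftrightarrow> z \<in> {..m}"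
    using AE_power_law_pos[OF zero_less_one]
  proof eventually_elim
    case (elim z)
    then show ?case
      using power_inv_le_iff[of p x z] power_inv_le_iff[of q y z] assms unfolding m_def by auto
  qed
  then have "measure (power_law 1) {z. power_inv p z \<le> x \<and> power_inv q z \<le> y} = measure (power_law 1) {..m}"
    by (rule finite_measure_eq_AE) measurable
  also have "\<dots> = m" using measure_power_law_atMost[of 1 m] m by simp
  finally show ?thesis by (simp add: m_def)
qed

locale marshall_olkin_construction =
  fixes \<phi> \<psi> :: real
  assumes phi: "0 \<le> \<phi>" "\<phi> \<le> 1" and psi: "0 \<le> \<psi>" "\<psi> \<le> 1"
begin

abbreviation "U \<equiv> power_law 1"
abbreviation "A \<equiv> power_law (1 - \<phi>)"
abbreviation "B \<equiv> power_law (1 - \<psi>)"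
abbreviation "M \<equiv> mo_space \<phi> \<psi>"
abbreviation "X \<equiv> mo_fst \<phi>"
abbreviation "Y \<equiv> mo_snd \<psi>"

sublocale U: prob_space U by (rule prob_space_power_law) simp
sublocale A: prob_space A by (rule prob_space_power_law) (use phi in simp)
sublocale B: prob_space B by (rule prob_space_power_law) (use psi in simp)
sublocale AB: pair_prob_space A B ..
sublocale UAB: pair_prob_space U "A \<Otimes>\<^sub>M B" ..

lemma M_def: "M = U \<Otimes>\<^sub>M (A \<Otimes>\<^sub>M B)" by (simp add: mo_space_def)

sublocale M: prob_space M unfolding M_def by (rule UAB.prob_space_axioms)

lemma X_measurable [measurable]: "X \<in> borel_measurable M"
  and Y_measurable [measurable]: "Y \<in> borel_measurable M"
  unfolding mo_fst_def mo_snd_def M_def by measurable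

lemma space_M [simp]: "space M = UNIV"
  by (simp add: M_def space_pair_measure)

lemma measure_M_Times:
  assumes "Q \<in> sets borel" "R \<in> sets borel" "S \<in> sets borel"
  shows "measure M (Q \<times> R \<times> S) = measure U Q * (measure A R * measure B S)"
  using assms unfolding M_def
  by (simp add: measure_def B.emeasure_pair_measure_Times AB.emeasure_pair_measure_Times enn2real_mult)

text \<open>The event is a box in \<open>(z, a, b)\<close>, so its probability is a product.
  Multiplying the minimum contributed by \<open>z\<close> with
  \<open>u powr (1 - \<phi>) * v powr (1 - \<psi>)\<close> completes \<open>u\<close> in one branch
  and \<open>v\<close> in the other.\<close>

lemma joint_cdf: "has_joint_cdf M X Y (marshall_olkin \<phi> \<psi>)"
proof -
  have "measure M {w \<in> space M. X w \<le> x \<and> Y w \<le> y} = marshall_olkin \<phi> \<psi> x y" for x y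
  proof -
    define m where "m = measure U {z. power_inv \<phi> z \<le> x \<and> power_inv \<psi> z \<le> y}"
    have set: "{w \<in> space M. X w \<le> x \<and> Y w \<le> y} =
        {z. power_inv \<phi> z \<le> x \<and> power_inv \<psi> z \<le> y} \<times> {..x} \<times> {..y}"
      by (auto simp: mo_fst_def mo_snd_def)
    have eq: "measure M {w \<in> space M. X w \<le> x \<and> Y w \<le> y} = m * (measure A {..x} * measure B {..y})"
      unfolding set m_def by (rule measure_M_Times) measurable
    show ?thesis
    proof (cases "0 < x \<and> 0 < y")
      case True
      define u v where "u = min 1 x" and "v = min 1 y"
      have uv: "0 < u" "u \<le> 1" "0 < v" "v \<le> 1" using True by (auto simp: u_def v_def)
      have cl: "clamp01 x = u" "clamp01 y = v" using True by (auto simp: clamp01_def u_def v_def)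
      have m: "m = min (u powr \<phi>) (v powr \<psi>)"
        using measure_power_inv_le_both[OF phi psi] True by (simp add: m_def u_def v_def)
      have A: "measure A {..x} = u powr (1 - \<phi>)" and B: "measure B {..y} = v powr (1 - \<psi>)"
        using measure_power_law_atMost[of "1 - \<phi>" x] measure_power_law_atMost[of "1 - \<psi>" y]
          True phi psi unfolding u_def v_def by simp_all
      have pu: "u powr \<phi> * u powr (1 - \<phi>) = u" and pv: "v powr \<psi> * v powr (1 - \<psi>) = v"
        using uv by (simp_all flip: powr_add)
      define c where "c = u powr (1 - \<phi>) * v powr (1 - \<psi>)"
      have "0 \<le> c" by (simp add: c_def)
      have "m * c = min (u powr \<phi> * c) (v powr \<psi> * c)"
        unfolding m min_mult_distrib_right using \<open>0 \<le> c\<close> by simp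
      also have "u powr \<phi> * c = u * v powr (1 - \<psi>)"
        unfolding c_def using pu by (metis mult.assoc)
      also have "v powr \<psi> * c = u powr (1 - \<phi>) * v"
        unfolding c_def using pv by (metis mult.left_commute)
      finally show ?thesis
        unfolding eq A B marshall_olkin_def Let_def cl c_def by (simp add: min.commute)
    next
      case False
      \<comment> \<open>For \<open>x \<le> 0\<close> only atoms at 0 could contribute. The
        individual shock has one only if \<open>\<phi> = 1\<close>, the common one only if
        \<open>\<phi> = 0\<close>, so one factor vanishes; likewise for \<open>y\<close>.\<close>
      have mx: "m \<le> measure (power_law \<phi>) {..x}" and my: "m \<le> measure (power_law \<psi>) {..y}"
        unfolding m_def measure_power_inv_le[OF phi(1), symmetric] measure_power_inv_le[OF psi(1), symmetric]
        by (auto intro!: U.finite_measure_mono)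
      have "m \<ge> 0" by (simp add: m_def)
      have "m * (measure A {..x} * measure B {..y}) = 0"
      proof (cases "x \<le> 0")
        case True
        then have "m = 0 \<or> measure A {..x} = 0"
          using measure_power_law_nonpos[of \<phi> x] measure_power_law_nonpos[of "1 - \<phi>" x] phi mx \<open>m \<ge> 0\<close>
          by (cases "\<phi> = 0 \<and> x = 0") auto
        then show ?thesis by auto
      next
        case x: False
        then have "y \<le> 0" using False by simp
        then have "m = 0 \<or> measure B {..y} = 0"
          using measure_power_law_nonpos[of \<psi> y] measure_power_law_nonpos[of "1 - \<psi>" y] psi my \<open>m \<ge> 0\<close>
          by (cases "\<psi> = 0 \<and> y = 0") auto
        then show ?thesis by auto
      qed
      moreover have "clamp01 x = 0 \<or> clamp01 y = 0" using False by (auto simp: clamp01_def)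
      moreover have "0 \<le> clamp01 x" "0 \<le> clamp01 y" by (simp_all add: clamp01_def)
      ultimately show ?thesis unfolding eq marshall_olkin_def Let_def by auto
    qed
  qed
  then show ?thesis
    using M.prob_space_axioms X_measurable Y_measurable by (simp add: has_joint_cdf_def)
qed

section \<open>Uniform margins\<close>

lemma distr_X: "distr M borel X = U"
  and distr_Y: "distr M borel Y = U"
proof -
  have "measure M (X -` {..x}) = measure U {..x}" and "measure M (Y -` {..x}) = measure U {..x}" for x
  proof -
    have eq: "X -` {..x} = {z. power_inv \<phi> z \<le> x} \<times> {..x} \<times> UNIV"
        "Y -` {..x} = {z. power_inv \<psi> z \<le> x} \<times> UNIV \<times> {..x}"
      by (auto simp: mo_fst_def mo_snd_def)
    have "measure A UNIV = 1" "measure B UNIV = 1" using A.prob_space B.prob_space by simp_all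
    then show "measure M (X -` {..x}) = measure U {..x}" "measure M (Y -` {..x}) = measure U {..x}"
      unfolding eq using phi psi
      by (simp_all add: measure_M_Times measure_power_inv_le measure_power_law_atMost_mult)
  qed
  then have cdf: "cdf (distr M borel X) = cdf U" "cdf (distr M borel Y) = cdf U"
    by (auto simp: cdf_def measure_distr fun_eq_iff)
  show "distr M borel X = U" "distr M borel Y = U"
    by (rule cdf_unique[OF M.real_distribution_distr real_distribution_power_law]; simp add: cdf)+
qed

lemma
  fixes f :: "real \<Rightarrow> real"
  assumes [measurable]: "f \<in> borel_measurable borel"
  shows integrable_X: "integrable M (\<lambda>w. f (X w)) \<longleftrightarrow> integrable U f"
    and integrable_Y: "integrable M (\<lambda>w. f (Y w)) \<longleftrightarrow> integrable U f"
    and integral_X: "M.expectation (\<lambda>w. f (X w)) = U.expectation f"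
    and integral_Y: "M.expectation (\<lambda>w. f (Y w)) = U.expectation f"
proof -
  show "integrable M (\<lambda>w. f (X w)) \<longleftrightarrow> integrable U f"
    "M.expectation (\<lambda>w. f (X w)) = U.expectation f"
    unfolding distr_X[symmetric] by (simp_all add: integrable_distr_eq integral_distr)
  show "integrable M (\<lambda>w. f (Y w)) \<longleftrightarrow> integrable U f"
    "M.expectation (\<lambda>w. f (Y w)) = U.expectation f"
    unfolding distr_Y[symmetric] by (simp_all add: integrable_distr_eq integral_distr)
qed

section \<open>Upper bound by conditioning on the common shock\<close>

text \<open>For fixed \<open>z\<close> the integrand is a function of \<open>a\<close> times a
  function of \<open>b\<close>, so the inner integral factorises: this is conditional independence
  given \<open>z\<close>.\<close>

lemma expectation_product:
  assumes [measurable]: "f \<in> borel_measurable borel" "g \<in> borel_measurable borel"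
    and i: "integrable M (\<lambda>w. f (X w) * g (Y w))"
  shows "M.expectation (\<lambda>w. f (X w) * g (Y w)) =
    U.expectation (\<lambda>z. max_cond \<phi> f (power_inv \<phi> z) * max_cond \<psi> g (power_inv \<psi> z))"
proof -
  note [measurable] = max_cond_measurable[OF assms(1) phi(2)] max_cond_measurable[OF assms(2) psi(2)]
  define h where "h z c = f (X (z, c)) * g (Y (z, c))" for z and c :: "real \<times> real"
  have ih: "integrable (U \<Otimes>\<^sub>M (A \<Otimes>\<^sub>M B)) (\<lambda>w. h (fst w) (snd w))"
    using i unfolding M_def h_def by simp
  have "M.expectation (\<lambda>w. f (X w) * g (Y w)) = integral\<^sup>L (U \<Otimes>\<^sub>M (A \<Otimes>\<^sub>M B)) (\<lambda>w. h (fst w) (snd w))"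
    unfolding M_def h_def by simp
  also have "\<dots> = U.expectation (\<lambda>z. integral\<^sup>L (A \<Otimes>\<^sub>M B) (h z))"
    using UAB.integral_fst'[OF ih] by simp
  also have "\<dots> = U.expectation (\<lambda>z. max_cond \<phi> f (power_inv \<phi> z) * max_cond \<psi> g (power_inv \<psi> z))"
  proof (rule integral_cong_AE)
    have "AE z in U. integrable (A \<Otimes>\<^sub>M B) (h z)"
      using UAB.AE_integrable_fst'[OF ih] by simp
    then show "AE z in U. integral\<^sup>L (A \<Otimes>\<^sub>M B) (h z) =
        max_cond \<phi> f (power_inv \<phi> z) * max_cond \<psi> g (power_inv \<psi> z)"
    proof eventually_elim
      case (elim z)
      have "integral\<^sup>L (A \<Otimes>\<^sub>M B) (h z) = (\<integral>a. \<integral>b. h z (a, b) \<partial>B \<partial>A)"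
        using AB.integral_fst'[OF elim] by simp
      also have "\<dots> = max_cond \<phi> f (power_inv \<phi> z) * max_cond \<psi> g (power_inv \<psi> z)"
        by (simp add: h_def mo_fst_def mo_snd_def max_cond_def)
      finally show ?case .
    qed
    show "(\<lambda>z. integral\<^sup>L (A \<Otimes>\<^sub>M B) (h z)) \<in> borel_measurable U"
      using borel_measurable_integrable[OF UAB.integrable_fst'[OF ih]] by simp
  qed measurable
  finally show ?thesis .
qed

text \<open>The conditional expectations for the two coordinates live under different power laws.
  The quantile transform moves both to the common uniform \<open>z\<close>, where Cauchy-Schwarz can
  be applied to them.\<close>

lemma
  fixes f :: "real \<Rightarrow> real"
  assumes p: "0 \<le> p" "p \<le> 1" and f [measurable]: "f \<in> borel_measurable borel"
    and f2: "integrable U (\<lambda>x. (f x)\<^sup>2)"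
  shows max_cond_inv_square_integrable: "integrable U (\<lambda>z. (max_cond p f (power_inv p z))\<^sup>2)"
    and expectation_max_cond_inv: "U.expectation (\<lambda>z. max_cond p f (power_inv p z)) = U.expectation f"
    and variance_max_cond_inv: "U.variance (\<lambda>z. max_cond p f (power_inv p z)) \<le> p * U.variance f"
proof -
  note [measurable] = max_cond_measurable[OF f p(2)]
  have f1: "integrable U f" by (rule U.square_integrable_imp_integrable[OF _ f2]) simp
  have int: "U.expectation (\<lambda>z. h (power_inv p z)) = integral\<^sup>L (power_law p) h"
    if [measurable]: "h \<in> borel_measurable borel" for h :: "real \<Rightarrow> real"
    unfolding distr_power_inv[OF p(1), symmetric] by (simp add: integral_distr)
  show "integrable U (\<lambda>z. (max_cond p f (power_inv p z))\<^sup>2)"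
    using max_cond_square_integrable[OF f p f2] unfolding distr_power_inv[OF p(1), symmetric]
    by (subst (asm) integrable_distr_eq) auto
  show E: "U.expectation (\<lambda>z. max_cond p f (power_inv p z)) = U.expectation f"
    using max_power_law_integral(3)[OF p f1] by (simp add: int)
  have "U.variance (\<lambda>z. max_cond p f (power_inv p z)) = prob_space.variance (power_law p) (max_cond p f)"
    unfolding E max_power_law_integral(3)[OF p f1]
    by (rule int[of "\<lambda>x. (max_cond p f x - U.expectation f)\<^sup>2"]) measurable
  then show "U.variance (\<lambda>z. max_cond p f (power_inv p z)) \<le> p * U.variance f"
    using variance_max_cond_le[OF f p f2] by simp
qed

text \<open>Conditional independence leaves only the covariance of the conditional expectations.
  Cauchy-Schwarz and the two variance contractions then give the factors \<open>\<phi>\<close> and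
  \<open>\<psi>\<close> under the root.\<close>

lemma covariance_XY_le:
  assumes f [measurable]: "f \<in> borel_measurable borel" and g [measurable]: "g \<in> borel_measurable borel"
    and f2: "integrable U (\<lambda>x. (f x)\<^sup>2)" and g2: "integrable U (\<lambda>x. (g x)\<^sup>2)"
  shows "covariance M (\<lambda>w. f (X w)) (\<lambda>w. g (Y w)) \<le> sqrt (\<phi> * \<psi>) * sqrt (U.variance f * U.variance g)"
proof -
  define F G where "F = (\<lambda>z. max_cond \<phi> f (power_inv \<phi> z))" and "G = (\<lambda>z. max_cond \<psi> g (power_inv \<psi> z))"
  note [measurable] = max_cond_measurable[OF f phi(2)] max_cond_measurable[OF g psi(2)]
  have FG [measurable]: "F \<in> borel_measurable borel" "G \<in> borel_measurable borel"
    unfolding F_def G_def by measurable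
  have F2: "integrable U (\<lambda>z. (F z)\<^sup>2)" and G2: "integrable U (\<lambda>z. (G z)\<^sup>2)"
    unfolding F_def G_def by (rule max_cond_inv_square_integrable; use phi psi f g f2 g2 in simp)+
  have sq1: "integrable U h" if "h \<in> borel_measurable borel" "integrable U (\<lambda>z. (h z)\<^sup>2)" for h :: "real \<Rightarrow> real"
    by (rule U.square_integrable_imp_integrable[OF _ that(2)]) (use that in simp)
  have fX2: "integrable M (\<lambda>w. (f (X w))\<^sup>2)" and gY2: "integrable M (\<lambda>w. (g (Y w))\<^sup>2)"
    using f2 g2 integrable_X[of "\<lambda>x. (f x)\<^sup>2"] integrable_Y[of "\<lambda>x. (g x)\<^sup>2"] by simp_all
  have fg: "integrable M (\<lambda>w. f (X w) * g (Y w))"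
    by (rule integrable_mult_of_squares[OF _ _ fX2 gY2]) measurable
  have "covariance M (\<lambda>w. f (X w)) (\<lambda>w. g (Y w)) =
      M.expectation (\<lambda>w. f (X w) * g (Y w)) - U.expectation f * U.expectation g"
    using M.covariance_eq[OF _ _ fg] sq1[OF f f2] sq1[OF g g2]
    by (simp add: integrable_X integrable_Y integral_X integral_Y)
  also have "\<dots> = U.expectation (\<lambda>z. F z * G z) - U.expectation F * U.expectation G"
    using expectation_product[OF f g fg] expectation_max_cond_inv[OF phi f f2] expectation_max_cond_inv[OF psi g g2]
    by (simp add: F_def G_def)
  also have "\<dots> = covariance U F G"
    by (rule U.covariance_eq[symmetric])
       (use sq1[OF FG(1) F2] sq1[OF FG(2) G2] integrable_mult_of_squares[OF _ _ F2 G2] in auto)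
  also have "\<dots> \<le> sqrt (U.variance F * U.variance G)"
    by (rule U.covariance_le) (use F2 G2 in auto)
  also have "\<dots> \<le> sqrt ((\<phi> * U.variance f) * (\<psi> * U.variance g))"
    unfolding F_def G_def
    using variance_max_cond_inv[OF phi f f2] variance_max_cond_inv[OF psi g g2] phi U.variance_positive[of f]
    by (intro real_sqrt_le_mono mult_mono) auto
  also have "(\<phi> * U.variance f) * (\<psi> * U.variance g) = (\<phi> * \<psi>) * (U.variance f * U.variance g)"
    by (simp add: mult_ac)
  finally show ?thesis by (simp only: real_sqrt_mult)
qed

lemma variance_X: "f \<in> borel_measurable borel \<Longrightarrow> M.variance (\<lambda>w. f (X w)) = U.variance f"
  and variance_Y: "f \<in> borel_measurable borel \<Longrightarrow> M.variance (\<lambda>w. f (Y w)) = U.variance f" for f :: "real \<Rightarrow> real"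
  using integral_X[of "\<lambda>x. (f x - U.expectation f)\<^sup>2"] integral_Y[of "\<lambda>x. (f x - U.expectation f)\<^sup>2"]
  by (simp_all add: integral_X integral_Y)

lemma pearson_corr_le:
  assumes f: "f \<in> borel_measurable borel" and g: "g \<in> borel_measurable borel"
    and vf: "has_pos_variance M (\<lambda>w. f (X w))" and vg: "has_pos_variance M (\<lambda>w. g (Y w))"
  shows "pearson_corr M (\<lambda>w. f (X w)) (\<lambda>w. g (Y w)) \<le> sqrt (\<phi> * \<psi>)"
proof -
  have f2: "integrable U (\<lambda>x. (f x)\<^sup>2)" and g2: "integrable U (\<lambda>x. (g x)\<^sup>2)"
    using vf vg f g integrable_X[of "\<lambda>x. (f x)\<^sup>2"] integrable_Y[of "\<lambda>x. (g x)\<^sup>2"]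
    by (simp_all add: has_pos_variance_def)
  have pos: "0 < U.variance f" "0 < U.variance g"
    using vf vg by (simp_all add: has_pos_variance_def variance_X[OF f] variance_Y[OF g])
  then have "0 < sqrt (U.variance f) * sqrt (U.variance g)" by simp
  then show ?thesis
    using covariance_XY_le[OF f g f2 g2]
    unfolding pearson_corr_def variance_X[OF f] variance_Y[OF g]
    by (simp only: pos_divide_le_eq real_sqrt_mult)
qed

section \<open>Lower bound from threshold indicators\<close>

lemma
  assumes u: "0 < u" "u < 1" and v: "0 < v" "v < 1"
  shows has_pos_variance_indicator: "has_pos_variance M (\<lambda>w. indicator {..u} (X w))"
      "has_pos_variance M (\<lambda>w. indicator {..v} (Y w))"
    and pearson_corr_indicator: "pearson_corr M (\<lambda>w. indicator {..u} (X w)) (\<lambda>w. indicator {..v} (Y w)) =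
      (marshall_olkin \<phi> \<psi> u v - u * v) / (sqrt (u * (1 - u)) * sqrt (v * (1 - v)))"
proof -
  have sq: "(indicat_real {..c} x)\<^sup>2 = indicat_real {..c} x" for c x by (simp add: indicator_def)
  have ind: "integrable U (indicat_real {..c})" for c
    by (rule integrable_real_indicator) (auto simp: U.emeasure_eq_measure)
  have E: "U.expectation (indicat_real {..c}) = c" if "0 < c" "c < 1" for c
    using measure_power_law_atMost[of 1 c] that by simp
  have var: "U.variance (indicat_real {..c}) = c * (1 - c)" if "0 < c" "c < 1" for c
  proof -
    have "integrable U (\<lambda>x. (indicat_real {..c} x)\<^sup>2)" unfolding sq by (rule ind)
    from U.variance_eq[OF ind this] have "U.variance (indicat_real {..c}) = c - c\<^sup>2"
      unfolding sq E[OF that] .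
    then show ?thesis by (simp add: power2_eq_square right_diff_distrib)
  qed
  have mi: "indicat_real {..c} \<in> borel_measurable borel" for c :: real by simp
  have Mvar: "M.variance (\<lambda>w. indicator {..u} (X w)) = u * (1 - u)"
      "M.variance (\<lambda>w. indicator {..v} (Y w)) = v * (1 - v)"
    unfolding variance_X[OF mi] variance_Y[OF mi] by (rule var[OF u], rule var[OF v])
  have pos: "0 < u * (1 - u)" "0 < v * (1 - v)" using u v by simp_all
  show "has_pos_variance M (\<lambda>w. indicator {..u} (X w))" "has_pos_variance M (\<lambda>w. indicator {..v} (Y w))"
    unfolding has_pos_variance_def sq Mvar using pos ind by (simp_all only: integrable_X[OF mi] integrable_Y[OF mi] simp_thms)
  have prod: "indicat_real {..u} (X w) * indicat_real {..v} (Y w) =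
      indicat_real {w \<in> space M. X w \<le> u \<and> Y w \<le> v} w" for w
    by (auto simp: indicator_def)
  have S: "{w \<in> space M. X w \<le> u \<and> Y w \<le> v} \<in> sets M" by measurable
  have "integrable M (\<lambda>w. indicat_real {..u} (X w) * indicat_real {..v} (Y w))"
    unfolding prod by (rule integrable_real_indicator) (use S in \<open>auto simp: M.emeasure_eq_measure\<close>)
  then have "covariance M (\<lambda>w. indicator {..u} (X w)) (\<lambda>w. indicator {..v} (Y w)) =
      M.expectation (\<lambda>w. indicat_real {..u} (X w) * indicat_real {..v} (Y w)) - u * v"
    by (subst M.covariance_eq)
       (auto simp: integrable_X integrable_Y integral_X integral_Y ind E[OF u] E[OF v] simp del: Bochner_Integration.integral_indicator)
  also have "M.expectation (\<lambda>w. indicat_real {..u} (X w) * indicat_real {..v} (Y w)) = marshall_olkin \<phi> \<psi> u v"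
    unfolding prod using joint_cdf S by (simp add: has_joint_cdf_def)
  finally show "pearson_corr M (\<lambda>w. indicator {..u} (X w)) (\<lambda>w. indicator {..v} (Y w)) =
      (marshall_olkin \<phi> \<psi> u v - u * v) / (sqrt (u * (1 - u)) * sqrt (v * (1 - v)))"
    unfolding pearson_corr_def Mvar by simp
qed

text \<open>The thresholds satisfy \<open>u\<^sup>\<phi> = v\<^sup>\<psi> = exp (- r)\<close>, so they lie on the singular curve of the copula,
  where the two terms of the minimum agree.\<close>

lemma pearson_corr_exp_indicator_ge:
  assumes pos: "0 < \<phi>" "0 < \<psi>" and r: "0 < r"
  defines "u \<equiv> exp (- (r / \<phi>))" and "v \<equiv> exp (- (r / \<psi>))"
  shows "sqrt (\<phi> * \<psi>) * sqrt (u * v) \<le>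
    pearson_corr M (\<lambda>w. indicator {..u} (X w)) (\<lambda>w. indicator {..v} (Y w))"
proof -
  have u: "0 < u" "u < 1" and v: "0 < v" "v < 1" using assms by (simp_all add: u_def v_def)
  have "u powr (1 - \<phi>) = u * exp r" "v powr (1 - \<psi>) = v * exp r"
    using pos by (simp_all add: u_def v_def powr_def field_simps flip: exp_add)
  then have C: "marshall_olkin \<phi> \<psi> u v = u * v * exp r"
    using u v by (simp add: marshall_olkin_def clamp01_def)
  \<comment> \<open>The inequality \<open>1 + t \<le> exp t\<close> serves on both sides: at
    negative \<open>t\<close> it bounds the variance factors \<open>1 - u\<close> and
    \<open>1 - v\<close> from above, and at \<open>t = r\<close> it bounds \<open>exp r - 1\<close>,
    the relative excess of the copula over independence, from below.\<close>
  have "1 - u \<le> r / \<phi>" "1 - v \<le> r / \<psi>"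
    using exp_ge_add_one_self[of "- (r / \<phi>)"] exp_ge_add_one_self[of "- (r / \<psi>)"]
    by (simp_all add: u_def v_def)
  then have "\<phi> * (1 - u) \<le> r" "\<psi> * (1 - v) \<le> r" using pos by (simp_all add: field_simps)
  then have "(\<phi> * (1 - u)) * (\<psi> * (1 - v)) \<le> r * r"
    using pos u v r by (intro mult_mono) auto
  then have "sqrt ((\<phi> * (1 - u)) * (\<psi> * (1 - v))) \<le> r"
    using r by (intro real_le_lsqrt) (auto simp: power2_eq_square)
  also have "r \<le> exp r - 1" using exp_ge_add_one_self[of r] by linarith
  finally have le: "(u * v) * sqrt ((\<phi> * (1 - u)) * (\<psi> * (1 - v))) \<le> (u * v) * (exp r - 1)"
    using u v by (intro mult_left_mono) auto
  \<comment> \<open>The extra factor \<open>sqrt (u * v)\<close> turns the \<open>u * v\<close>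
    under the root into a perfect square; it tends to 1 with \<open>r\<close>.\<close>
  have "sqrt (\<phi> * \<psi>) * sqrt (u * v) * (sqrt (u * (1 - u)) * sqrt (v * (1 - v))) =
      sqrt ((u * v)\<^sup>2 * ((\<phi> * (1 - u)) * (\<psi> * (1 - v))))"
    by (simp add: power2_eq_square mult_ac flip: real_sqrt_mult)
  also have "\<dots> = (u * v) * sqrt ((\<phi> * (1 - u)) * (\<psi> * (1 - v)))"
    using u v by (simp add: real_sqrt_mult)
  finally have "sqrt (\<phi> * \<psi>) * sqrt (u * v) * (sqrt (u * (1 - u)) * sqrt (v * (1 - v))) \<le>
      marshall_olkin \<phi> \<psi> u v - u * v"
    using le unfolding C by (simp add: right_diff_distrib)
  moreover have "0 < sqrt (u * (1 - u)) * sqrt (v * (1 - v))" using u v by simp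
  ultimately show ?thesis
    unfolding pearson_corr_indicator[OF u v] by (simp only: pos_le_divide_eq)
qed

lemma max_corr_eq: "max_corr M X Y = sqrt (\<phi> * \<psi>)"
proof -
  define S where "S = {pearson_corr M (\<lambda>w. f (X w)) (\<lambda>w. g (Y w)) | f g :: real \<Rightarrow> real.
      f \<in> borel_measurable borel \<and> g \<in> borel_measurable borel \<and>
      has_pos_variance M (\<lambda>w. f (X w)) \<and> has_pos_variance M (\<lambda>w. g (Y w))}"
  have le: "s \<le> sqrt (\<phi> * \<psi>)" if "s \<in> S" for s
    using that pearson_corr_le unfolding S_def by blast
  then have bdd: "bdd_above S" by (rule bdd_aboveI)
  have ind: "pearson_corr M (\<lambda>w. indicator {..u} (X w)) (\<lambda>w. indicator {..v} (Y w)) \<in> S"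
    if "0 < u" "u < 1" "0 < v" "v < 1" for u v
    unfolding S_def using has_pos_variance_indicator[OF that]
    by (intro CollectI exI[of _ "indicat_real {..u}"] exI[of _ "indicat_real {..v}"]) auto
  \<comment> \<open>Any interior thresholds would do; nonemptiness is required for the
    least-upper-bound rule.\<close>
  have "S \<noteq> {}" using ind[of "1/2" "1/2"] by auto
  then have "Sup S \<le> sqrt (\<phi> * \<psi>)" using le by (rule cSup_least)
  moreover have "sqrt (\<phi> * \<psi>) \<le> Sup S"
  proof (cases "0 < \<phi> \<and> 0 < \<psi>")
    case True
    have "sqrt (\<phi> * \<psi>) * sqrt (exp (- (r / \<phi>)) * exp (- (r / \<psi>))) \<le> Sup S" if "0 < r" for r
    proof -
      have "exp (- (r / \<phi>)) < 1" "exp (- (r / \<psi>)) < 1" using that True by simp_all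
      from cSup_upper[OF ind[OF exp_gt_zero this(1) exp_gt_zero this(2)] bdd]
      show ?thesis using pearson_corr_exp_indicator_ge[of r] True that by linarith
    qed
    then have "\<forall>\<^sub>F r in at_right 0.
        sqrt (\<phi> * \<psi>) * sqrt (exp (- (r / \<phi>)) * exp (- (r / \<psi>))) \<le> Sup S"
      by (auto simp: eventually_at_right_less eventually_at_filter)
    moreover have "((\<lambda>r. sqrt (\<phi> * \<psi>) * sqrt (exp (- (r / \<phi>)) * exp (- (r / \<psi>)))) \<longlongrightarrow>
        sqrt (\<phi> * \<psi>)) (at_right 0)"
      using True by (auto intro!: tendsto_eq_intros)
    ultimately show ?thesis by (intro tendsto_upperbound) auto
  next
    case False
    then have z: "\<phi> = 0 \<or> \<psi> = 0" using phi psi by auto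
    \<comment> \<open>The exponential thresholds degenerate to 1 here, as division by 0 yields 0.
      Instead, one of \<open>a\<close>, \<open>b\<close> equals \<open>1/2\<close> and the other is
      at least \<open>1/2\<close>, so the copula agrees with independence at
      \<open>(1/2, 1/2)\<close>, and the correlation 0 is attained.\<close>
    define a b :: real where "a = (1/2) powr (1 - \<phi>)" and "b = (1/2) powr (1 - \<psi>)"
    have "1/2 \<le> a" "1/2 \<le> b"
      using powr_mono'[of "1 - \<phi>" 1 "1/2::real"] powr_mono'[of "1 - \<psi>" 1 "1/2::real"] phi psi
      by (simp_all add: a_def b_def)
    moreover have "a = 1/2 \<or> b = 1/2" using z by (auto simp: a_def b_def)
    moreover have "marshall_olkin \<phi> \<psi> (1/2) (1/2) = min (a * (1/2)) (1/2 * b)"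
      by (simp add: marshall_olkin_def clamp01_def Let_def a_def b_def)
    ultimately have "marshall_olkin \<phi> \<psi> (1/2) (1/2) = 1/2 * (1/2)"
      by (auto simp: min_def)
    then have "pearson_corr M (\<lambda>w. indicator {..1/2} (X w)) (\<lambda>w. indicator {..1/2} (Y w)) = 0"
      using pearson_corr_indicator[of "1/2" "1/2"] by simp
    then have "0 \<in> S" using ind[of "1/2" "1/2"] by simp
    then show ?thesis using cSup_upper[OF _ bdd] z by auto
  qed
  ultimately show ?thesis unfolding max_corr_def S_def[symmetric] by simp
qed

end

theorem theorem2p1:
  fixes \<phi> \<psi> :: real
  assumes "\<phi> \<in> {0..1}" and "\<psi> \<in> {0..1}"
  shows "max_corr_cdf (marshall_olkin \<phi> \<psi>) = sqrt (\<phi> * \<psi>)"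
proof -
  interpret marshall_olkin_construction \<phi> \<psi> using assms by unfold_locales auto
  show ?thesis using max_corr_eq max_corr_eq_max_corr_cdf[OF joint_cdf] by simp
qed

end
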